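(* Let $p\ge 3$, let $Z=(Z_1,\dots,Z_p) \sim N(0,\Sigma)$ be a non-trivial centered Gaussian vector in $\mathbb{R}^p$ (with $\Sigma$ otherwise arbitrary), let $\sigma_{\max}^2 = \max_{1 \le i \le p} \mathbb{E}[Z_i^2]$ with $\sigma_{\max}>0$, and let $M^* = \max_{1 \le i \le p} |Z_i|$. Then, for every $t \ge 0$, $$\lim_{\delta \downarrow 0} \frac{1}{\delta}\, \mathbb{P}\left\{ t \le M^* < t+ \delta \right\} \;\le\; \frac{4\log(2p)}{\max\{\sigma_{\max},\, t\}}.$$
   Context: $\log$ is the natural logarithm. Non-trivial means that at least one coordinate has positive variance. The covariance may be singular. *)

theory Defs
  imports "HOL-Probability.Probability"
begin

text \<open>The law \<open>N(\<mu>, v)\<close> on the real line, parametrised by its variance \<open>v \<ge> 0\<close>;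
  the degenerate case \<open>v = 0\<close> is the point mass at \<open>\<mu>\<close>.\<close>

definition normal_law :: "real \<Rightarrow> real \<Rightarrow> real measure" where
  "normal_law \<mu> v =
     (if v = 0 then return borel \<mu> else density lborel (normal_density \<mu> (sqrt v)))"

definition positive_semidefinite :: "real ^ 'n ^ 'n \<Rightarrow> bool" where
  "positive_semidefinite A \<longleftrightarrow> transpose A = A \<and> (\<forall>u. 0 \<le> u \<bullet> (A *v u))"

text \<open>\<open>Z \<sim> N(\<mu>, \<Sigma>)\<close>: every linear functional of \<open>Z\<close> is a (possibly degenerate) normal random
  variable, with the mean and variance prescribed by \<open>\<mu>\<close> and \<open>\<Sigma>\<close>. The matrix \<open>\<Sigma>\<close> may be
  singular, so no density of \<open>Z\<close> on the whole space is assumed.\<close>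

definition gaussian_vector ::
    "'a measure \<Rightarrow> ('a \<Rightarrow> real ^ 'n) \<Rightarrow> real ^ 'n \<Rightarrow> real ^ 'n ^ 'n \<Rightarrow> bool" where
  "gaussian_vector M Z \<mu> \<Sigma> \<longleftrightarrow>
     Z \<in> borel_measurable M \<and> positive_semidefinite \<Sigma> \<and>
     (\<forall>u. distr M borel (\<lambda>\<omega>. u \<bullet> Z \<omega>) = normal_law (u \<bullet> \<mu>) (u \<bullet> (\<Sigma> *v u)))"

end

theory Submission imports Defs begin

text \<open>
  Write \<open>M\<^sup>*\<close> as a maximum of at most \<open>2p\<close> non-degenerate Gaussians \<open>X\<^sub>j\<close> with standard deviations
  \<open>\<sigma>\<^sub>j\<close>. Its right density at \<open>t\<close> is \<open>L = \<Sum>\<^sub>j \<phi>\<^sub>j(t) \<pi>\<^sub>j\<close>, where \<open>\<phi>\<^sub>j\<close> is the density of \<open>X\<^sub>j\<close> and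
  \<open>\<pi>\<^sub>j\<close> the conditional probability that \<open>j\<close> attains the maximum given \<open>X\<^sub>j = t\<close>; the limit exists
  because \<open>\<pi>\<^sub>j\<close> is governed by inequalities that are affine in \<open>t\<close>.

  Moving the faces of the polytope outwards along their normals sweeps out disjoint regions, so
  \<open>\<Sum>\<^sub>j P(X\<^sub>j > t) \<pi>\<^sub>j \<le> 1\<close>. For \<open>t \<le> K \<sigma>\<^sub>j\<close> the Mills ratio gives \<open>t \<phi>\<^sub>j(t) \<le> (K\<^sup>2 + 1) P(X\<^sub>j > t)\<close>;
  the remaining terms are at most \<open>K \<phi>(K)\<close> each. With \<open>K\<^sup>2 = 2 log(2p) - 2\<close> this yields
  \<open>t L \<le> 4 log(2p) / sqrt e\<close>, which is more than needed when \<open>t \<ge> \<sigma>\<^sub>m\<^sub>a\<^sub>x\<close>.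

  If \<open>0 < t < \<sigma>\<^sub>m\<^sub>a\<^sub>x\<close>, shrink the coordinate of largest variance, keeping the independent residual,
  until its standard deviation is \<open>t\<close>. On \<open>{M\<^sup>* \<le> t}\<close> this multiplies probabilities by at least
  \<open>\<sigma>\<^sub>m\<^sub>a\<^sub>x / (t sqrt e)\<close>, and the previous bound applies to the shrunk vector: the factor \<open>sqrt e\<close>
  saved above is exactly what is spent here.
\<close>

section \<open>Measures determined by their trigonometric integrals\<close>

text \<open>Cosines with a free phase include sines, so the hypothesis fixes the characteristic
  function. Dividing by the total mass, which \<open>s = 0\<close>, \<open>\<theta> = 0\<close>
  shows to be common, reduces to Levy uniqueness. Only finiteness is assumed because the weighted
  marginals to be compared are not normalised.\<close>

lemma finite_real_measure_eqI_cos: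
  fixes N1 N2 :: "real measure"
  assumes "finite_measure N1" "finite_measure N2"
    and sets: "sets N1 = sets borel" "sets N2 = sets borel"
    and eq: "\<And>s \<theta>. (\<integral>x. cos (s * x + \<theta>) \<partial>N1) = (\<integral>x. cos (s * x + \<theta>) \<partial>N2)"
  shows "N1 = N2"
proof -
  interpret N1: finite_measure N1 by fact
  interpret N2: finite_measure N2 by fact
  have sp: "space N1 = UNIV" "space N2 = UNIV"
    using sets_eq_imp_space_eq[OF sets(1)] sets_eq_imp_space_eq[OF sets(2)] by auto
  define c where "c = measure N1 UNIV"
  have c2: "measure N2 UNIV = c"
    using eq[of 0 0] by (simp add: c_def sp)
  have em: "emeasure N1 UNIV = ennreal c" "emeasure N2 UNIV = ennreal c"
    by (auto simp: c_def N1.emeasure_eq_measure N2.emeasure_eq_measure c2[unfolded c_def])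
  show ?thesis
  proof (cases "c = 0")
    case True
    have "emeasure N1 A = emeasure N2 A" for A
      using emeasure_space[of N1 A] emeasure_space[of N2 A] em True sp by simp
    then show ?thesis using sets by (intro measure_eqI) auto
  next
    case False
    then have c: "c > 0" by (simp add: c_def zero_less_measure_iff)
    let ?D = "\<lambda>N. density N (\<lambda>_. ennreal (1/c))"
    have rd: "real_distribution (?D N)" if "N = N1 \<or> N = N2" for N
    proof -
      have "emeasure N UNIV = ennreal c" "sets N = sets borel" "space N = UNIV"
        using that em sets sp by auto
      then have "emeasure (?D N) (space (?D N)) = 1"
        using c by (auto simp: emeasure_density_const ennreal_mult'[symmetric])
      with \<open>sets N = sets borel\<close> \<open>space N = UNIV\<close> show ?thesis
        by (auto simp: real_distribution_def real_distribution_axioms_def intro: prob_spaceI)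
    qed
    have ch: "char (?D N1) t = char (?D N2) t" for t
    proof -
      have Dint: "integral\<^sup>L (?D N) f = (1/c) * integral\<^sup>L N f"
        if "N = N1 \<or> N = N2" "f \<in> borel_measurable borel" for N and f :: "real \<Rightarrow> real"
      proof -
        have "f \<in> borel_measurable N" using that sets by (auto cong: measurable_cong_sets)
        then show ?thesis using c by (subst integral_density) auto
      qed
      have Dcos: "integral\<^sup>L (?D N1) (\<lambda>x. cos (s * x + \<theta>)) = integral\<^sup>L (?D N2) (\<lambda>x. cos (s * x + \<theta>))" for s \<theta>
        by (subst (1 2) Dint) (auto simp: eq)
      have sc: "sin (t * x) = cos (t * x + (- (pi/2)))" for x
        by (simp only: cos_add cos_minus sin_minus) simp
      have "Re (char (?D N) t) = integral\<^sup>L (?D N) (\<lambda>x. cos (t * x + 0))"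
        "Im (char (?D N) t) = integral\<^sup>L (?D N) (\<lambda>x. cos (t * x + (- (pi/2))))" if "N = N1 \<or> N = N2" for N
      proof -
        interpret real_distribution "?D N" by (rule rd) fact
        have "(\<lambda>x. complex_of_real (t * x)) \<in> borel_measurable borel" by measurable
        then have "(\<lambda>x. complex_of_real (t * x)) \<in> borel_measurable (?D N)"
          using that sets by (auto simp: measurable_cong_sets[of N borel borel borel])
        then have int: "integrable (?D N) (\<lambda>x. iexp (t * x))" by (rule integrable_iexp) simp
        have "Re (char (?D N) t) = integral\<^sup>L (?D N) (\<lambda>x. Re (iexp (t * x)))"
          unfolding char_def by (rule integral_Re[OF int, symmetric])
        also have "\<dots> = integral\<^sup>L (?D N) (\<lambda>x. cos (t * x + 0))"
          by (simp add: Re_exp)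
        finally show "Re (char (?D N) t) = integral\<^sup>L (?D N) (\<lambda>x. cos (t * x + 0))" .
        have "Im (char (?D N) t) = integral\<^sup>L (?D N) (\<lambda>x. Im (iexp (t * x)))"
          unfolding char_def by (rule integral_Im[OF int, symmetric])
        also have "\<dots> = integral\<^sup>L (?D N) (\<lambda>x. cos (t * x + (- (pi/2))))"
          by (simp only: sc[symmetric]) (simp add: Im_exp)
        finally show "Im (char (?D N) t) = integral\<^sup>L (?D N) (\<lambda>x. cos (t * x + (- (pi/2))))" .
      qed
      then show ?thesis by (simp only: complex_eq_iff Dcos simp_thms)
    qed
    have D: "?D N1 = ?D N2"
      by (intro Levy_uniqueness rd ext ch) auto
    have "emeasure N1 A = emeasure N2 A" if "A \<in> sets N1" for A
    proof -
      have "ennreal (1/c) * emeasure N1 A = ennreal (1/c) * emeasure N2 A"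
        using arg_cong[OF D, of "\<lambda>D. emeasure D A"] that sets by (simp add: emeasure_density_const)
      then have "ennreal (c * (1/c)) * emeasure N1 A = ennreal (c * (1/c)) * emeasure N2 A"
        using c by (simp only: ennreal_mult'[of c] mult.assoc less_imp_le)
      then show ?thesis using c by simp
    qed
    then show ?thesis using sets by (intro measure_eqI) auto
  qed
qed

text \<open>Induction over the coordinates: one more indicator is absorbed by comparing weighted
  marginals on the line. The cosine factor stays in the statement so that the induction hypothesis
  still determines those marginals.\<close>

lemma integral_indicator_prod_cos_eq:
  fixes N1 N2 :: "'a::euclidean_space measure"
  assumes "prob_space N1" "prob_space N2"
    and sets: "sets N1 = sets borel" "sets N2 = sets borel"
    and eq: "\<And>u \<theta>. (\<integral>x. cos (u \<bullet> x + \<theta>) \<partial>N1) = (\<integral>x. cos (u \<bullet> x + \<theta>) \<partial>N2)"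
    and "finite S" and A: "\<And>b. A b \<in> sets borel"
  shows "(\<integral>x. (\<Prod>b\<in>S. indicator (A b) (x \<bullet> b)) * cos (u \<bullet> x + \<theta>) \<partial>N1) =
         (\<integral>x. (\<Prod>b\<in>S. indicator (A b) (x \<bullet> b)) * cos (u \<bullet> x + \<theta>) \<partial>N2)"
  using \<open>finite S\<close>
proof (induction S arbitrary: u \<theta> rule: finite_induct)
  case empty
  then show ?case by (simp add: eq)
next
  case (insert b S)
  define g where "g x = (\<Prod>b\<in>S. indicator (A b) (x \<bullet> b) :: real)" for x :: 'a
  define h where "h x = (indicator (A b) (x \<bullet> b) :: real)" for x :: 'a
  have gm[measurable]: "g \<in> borel_measurable borel" and hm[measurable]: "h \<in> borel_measurable borel"
    using A unfolding g_def h_def by measurable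
  have g01: "0 \<le> g x" "g x \<le> 1" for x
    unfolding g_def by (auto intro!: prod_nonneg prod_le_1)
  have h01: "0 \<le> h x" "h x \<le> 1" for x
    unfolding h_def by (auto split: split_indicator)
  have IH: "(\<integral>x. g x * cos (u \<bullet> x + \<theta>) \<partial>N1) = (\<integral>x. g x * cos (u \<bullet> x + \<theta>) \<partial>N2)" for u \<theta>
    using insert.IH by (simp add: g_def)
  have bnd: "integrable N f" if "N = N1 \<or> N = N2" "f \<in> borel_measurable borel" "\<And>x. \<bar>f x\<bar> \<le> 4" for N and f :: "'a \<Rightarrow> real"
  proof -
    interpret prob_space N using that(1) assms by auto
    have "f \<in> borel_measurable N" using that sets by (auto cong: measurable_cong_sets)
    then show ?thesis using that(3) by (intro integrable_const_bound[where B=4]) auto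
  qed
  have gc4: "\<bar>g x * cos y\<bar> \<le> 4" for x y
  proof -
    have "\<bar>g x * cos y\<bar> \<le> 1 * 1"
      unfolding abs_mult using g01[of x] by (intro mult_mono) auto
    then show ?thesis by simp
  qed
  have gc: "integrable N (\<lambda>x. g x * cos (u \<bullet> x + \<theta>))" if "N = N1 \<or> N = N2" for N u \<theta>
    using that by (rule bnd) (auto simp: gc4)
  \<comment> \<open>Adding \<open>1\<close> to the cosine makes the weight nonnegative, hence a
    density; the extra term is subtracted again at the end.\<close>
  define w where "w u \<theta> x = g x * (1 + cos (u \<bullet> x + \<theta>))" for u \<theta> and x :: 'a
  have wm[measurable]: "w u \<theta> \<in> borel_measurable borel" for u \<theta> unfolding w_def by measurable
  have w0: "0 \<le> w u \<theta> x" for u \<theta> x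
    unfolding w_def using g01(1)[of x] cos_ge_minus_one[of "u \<bullet> x + \<theta>"]
    by (intro mult_nonneg_nonneg) linarith+
  have w4: "w u \<theta> x \<le> 4" for u \<theta> x
  proof -
    have "w u \<theta> x \<le> 1 * (1 + cos (u \<bullet> x + \<theta>))"
      unfolding w_def using g01(2)[of x] cos_ge_minus_one[of "u \<bullet> x + \<theta>"]
      by (intro mult_right_mono) linarith+
    also have "\<dots> \<le> 4" by (simp add: order_trans[OF cos_le_one])
    finally show ?thesis .
  qed
  have key: "(\<integral>x. w u \<theta> x * h x \<partial>N1) = (\<integral>x. w u \<theta> x * h x \<partial>N2)" for u \<theta>
  proof -
    let ?D = "\<lambda>N. distr (density N (\<lambda>x. ennreal (w u \<theta> x))) borel (\<lambda>x. x \<bullet> b)"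
    have Dint: "(\<integral>y. f y \<partial>?D N) = (\<integral>x. w u \<theta> x * f (x \<bullet> b) \<partial>N)"
      if "N = N1 \<or> N = N2" "f \<in> borel_measurable borel" for N and f :: "real \<Rightarrow> real"
    proof -
      have [measurable_cong]: "sets N = sets borel" using that sets by auto
      note that(2)[measurable]
      show ?thesis
        by (subst integral_distr, simp, simp, subst integral_density) (auto simp: w0)
    qed
    have fin: "finite_measure (?D N)" if "N = N1 \<or> N = N2" for N
    proof -
      interpret prob_space N using that assms by auto
      have [measurable_cong]: "sets N = sets borel" using that sets by auto
      have "emeasure (?D N) (space (?D N)) = (\<integral>\<^sup>+x. ennreal (w u \<theta> x) \<partial>N)"
        by (subst emeasure_distr) (auto simp: emeasure_density intro!: nn_integral_cong)
      also have "\<dots> \<le> (\<integral>\<^sup>+x. 4 \<partial>N)"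
        by (intro nn_integral_mono) (metis ennreal_leI ennreal_numeral w4 zero_le_numeral)
      also have "\<dots> < \<infinity>" by (simp add: emeasure_space_1)
      finally show ?thesis by (intro finite_measureI) auto
    qed
    \<comment> \<open>The product-to-sum formula splits each cosine integral of the weighted
      marginal into three integrals covered by \<open>IH\<close>.\<close>
    have Dcos: "(\<integral>y. cos (s * y + \<phi>) \<partial>?D N) = (\<integral>x. g x * cos ((s *\<^sub>R b) \<bullet> x + \<phi>) \<partial>N)
       + (1/2) * (\<integral>x. g x * cos ((u + s *\<^sub>R b) \<bullet> x + (\<theta> + \<phi>)) \<partial>N)
       + (1/2) * (\<integral>x. g x * cos ((u - s *\<^sub>R b) \<bullet> x + (\<theta> - \<phi>)) \<partial>N)" if "N = N1 \<or> N = N2" for N s \<phi>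
    proof -
      have e: "w u \<theta> x * cos (s * (x \<bullet> b) + \<phi>) = g x * cos ((s *\<^sub>R b) \<bullet> x + \<phi>)
        + (1/2) * (g x * cos ((u + s *\<^sub>R b) \<bullet> x + (\<theta> + \<phi>)))
        + (1/2) * (g x * cos ((u - s *\<^sub>R b) \<bullet> x + (\<theta> - \<phi>)))" for x
      proof -
        have e: "s * (x \<bullet> b) = (s *\<^sub>R b) \<bullet> x" by (simp add: inner_commute)
        have e2: "u \<bullet> x + \<theta> - ((s *\<^sub>R b) \<bullet> x + \<phi>) = (u - s *\<^sub>R b) \<bullet> x + (\<theta> - \<phi>)"
          "u \<bullet> x + \<theta> + ((s *\<^sub>R b) \<bullet> x + \<phi>) = (u + s *\<^sub>R b) \<bullet> x + (\<theta> + \<phi>)"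
          by (simp_all only: inner_diff_left inner_add_left)
        have c: "cos (u \<bullet> x + \<theta>) * cos ((s *\<^sub>R b) \<bullet> x + \<phi>) =
          (cos ((u - s *\<^sub>R b) \<bullet> x + (\<theta> - \<phi>)) + cos ((u + s *\<^sub>R b) \<bullet> x + (\<theta> + \<phi>))) / 2"
          by (simp only: cos_times_cos e2)
        have "w u \<theta> x * cos (s * (x \<bullet> b) + \<phi>) =
          g x * (cos ((s *\<^sub>R b) \<bullet> x + \<phi>) + cos (u \<bullet> x + \<theta>) * cos ((s *\<^sub>R b) \<bullet> x + \<phi>))"
          unfolding w_def e by (simp only: distrib_left distrib_right mult_1 mult_1_right mult.assoc)
        then show ?thesis unfolding c by (simp add: distrib_left add_divide_distrib)
      qed
      show ?thesis
        using gc[OF that] by (subst Dint[OF that]) (simp_all add: e del: inner_scaleR_left)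
    qed
    have "?D N1 = ?D N2"
      by (intro finite_real_measure_eqI_cos fin) (simp_all only: Dcos simp_thms IH sets_distr)
    then have "(\<integral>y. indicator (A b) y \<partial>?D N1) = (\<integral>y. indicator (A b) y \<partial>?D N2 :: real)" by simp
    then show ?thesis using A by (subst (asm) (1 2) Dint) (simp_all add: h_def)
  qed
  have ghc: "integrable N (\<lambda>x. g x * h x * cos (u \<bullet> x + \<theta>))" if "N = N1 \<or> N = N2" for N u \<theta>
  proof (rule bnd[OF that])
    fix x
    have "\<bar>(g x * cos (u \<bullet> x + \<theta>)) * h x\<bar> \<le> 4 * 1"
      unfolding abs_mult[of _ "h x"] using gc4 h01[of x] by (intro mult_mono) auto
    then show "\<bar>g x * h x * cos (u \<bullet> x + \<theta>)\<bar> \<le> 4" by (simp add: mult_ac)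
  qed measurable
  have split: "(\<integral>x. w u \<theta> x * h x \<partial>N) = (\<integral>x. g x * h x * cos (0 \<bullet> x + 0) \<partial>N) + (\<integral>x. g x * h x * cos (u \<bullet> x + \<theta>) \<partial>N)"
    if "N = N1 \<or> N = N2" for N u \<theta>
  proof -
    have "w u \<theta> x * h x = g x * h x * cos (0 \<bullet> x + 0) + g x * h x * cos (u \<bullet> x + \<theta>)" for x
      by (simp add: w_def algebra_simps)
    then show ?thesis using ghc[OF that] by (simp only: Bochner_Integration.integral_add)
  qed
  \<comment> \<open>At \<open>u = 0\<close>, \<open>\<theta> = 0\<close> the weight is
    \<open>2 * g x\<close>, which isolates the extra term.\<close>
  have z: "(\<integral>x. g x * h x * cos (0 \<bullet> x + 0) \<partial>N1) = (\<integral>x. g x * h x * cos (0 \<bullet> x + 0) \<partial>N2)"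
    using key[of 0 0] split[of N1 0 0] split[of N2 0 0] by simp
  have "(\<integral>x. g x * h x * cos (u \<bullet> x + \<theta>) \<partial>N1) = (\<integral>x. g x * h x * cos (u \<bullet> x + \<theta>) \<partial>N2)"
    using key[of u \<theta>] split[of N1 u \<theta>] split[of N2 u \<theta>] z by simp
  then show ?case using insert.hyps by (simp add: g_def h_def mult_ac)
qed

text \<open>A Cramer-Wold principle: the indicator of a box is a product of coordinate indicators,
  and boxes are an intersection-stable generator of the Borel sets.\<close>

lemma measure_eqI_inner_cos:
  fixes N1 N2 :: "'a::euclidean_space measure"
  assumes "prob_space N1" "prob_space N2"
    and sets: "sets N1 = sets borel" "sets N2 = sets borel"
    and eq: "\<And>u \<theta>. (\<integral>x. cos (u \<bullet> x + \<theta>) \<partial>N1) = (\<integral>x. cos (u \<bullet> x + \<theta>) \<partial>N2)"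
  shows "N1 = N2"
proof -
  interpret N1: prob_space N1 by fact
  interpret N2: prob_space N2 by fact
  have box: "measure N1 (box c d) = measure N2 (box c d)" for c d
  proof -
    have b: "(\<Prod>b\<in>Basis. indicator {c \<bullet> b <..< d \<bullet> b} (x \<bullet> b)) = (indicator (box c d) x :: real)" for x
      by (auto simp: box_def indicator_def prod_zero_iff)
    have "(\<integral>x. (\<Prod>b\<in>Basis. indicator {c \<bullet> b <..< d \<bullet> b} (x \<bullet> b)) * cos (0 \<bullet> x + 0) \<partial>N1) =
         (\<integral>x. (\<Prod>b\<in>Basis. indicator {c \<bullet> b <..< d \<bullet> b} (x \<bullet> b)) * cos (0 \<bullet> x + 0) \<partial>N2)"
      by (rule integral_indicator_prod_cos_eq[OF assms]) auto
    then have "(\<integral>x. indicator (box c d) x \<partial>N1 :: real) = (\<integral>x. indicator (box c d) x \<partial>N2)"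
      by (simp add: b)
    moreover have "box c d \<in> sets N1" "box c d \<in> sets N2" using sets by auto
    ultimately show ?thesis by (simp add: sets)
  qed
  let ?E = "range (\<lambda>(a, b). box a b :: 'a set)"
  let ?A = "\<lambda>n::nat. box (- (real n *\<^sub>R One)) (real n *\<^sub>R One) :: 'a set"
  show ?thesis
  proof (rule measure_eqI_generator_eq)
    show "Int_stable ?E" by (auto simp: Int_stable_def box_Int_box)
    show "?E \<subseteq> Pow UNIV" "sets N1 = sigma_sets UNIV ?E" "sets N2 = sigma_sets UNIV ?E"
      by (simp_all add: borel_eq_box sets)
    show "range ?A \<subseteq> ?E" "(\<Union>i. ?A i) = UNIV"
      unfolding UN_box_eq_UNIV by auto
    show "emeasure N1 (?A i) \<noteq> \<infinity>" for i by simp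
    show "emeasure N1 X = emeasure N2 X" if "X \<in> ?E" for X
      using that by (auto simp: N1.emeasure_eq_measure N2.emeasure_eq_measure box)
  qed
qed

section \<open>Independence of a coordinate and its residual\<close>

text \<open>Real and imaginary parts of the standard normal characteristic function, rescaled by
  \<open>\<sigma>\<close>; the point mass \<open>v = 0\<close> obeys the same formula.\<close>

lemma integral_normal_law_cos:
  assumes "0 \<le> v"
  shows "(\<integral>x. cos (s * x + \<theta>) \<partial>normal_law 0 v) = exp (- (v * s\<^sup>2) / 2) * cos \<theta>"
proof (cases "v = 0")
  case True
  then show ?thesis by (simp add: normal_law_def integral_return)
next
  case False
  with assms have v: "v > 0" by simp
  define \<sigma> where "\<sigma> = sqrt v"
  have \<sigma>: "\<sigma> > 0" "\<sigma>\<^sup>2 = v" using v by (auto simp: \<sigma>_def)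
  interpret S: real_distribution std_normal_distribution by (rule real_dist_normal_dist)
  define r where "r = s * \<sigma>"
  have "(\<lambda>x. complex_of_real (r * x)) \<in> borel_measurable std_normal_distribution" by simp
  then have int: "complex_integrable std_normal_distribution (\<lambda>x. iexp (r * x))"
    by (rule S.integrable_iexp) simp
  have ch: "(CLINT x|std_normal_distribution. iexp (r * x)) = complex_of_real (exp (- r\<^sup>2 / 2))"
    using fun_cong[OF char_std_normal_distribution, of r] by (simp add: char_def)
  have c: "(\<integral>x. cos (r * x) \<partial>std_normal_distribution) = exp (- r\<^sup>2 / 2)"
    using integral_Re[OF int] unfolding ch by (simp add: Re_exp)
  have sn: "(\<integral>x. sin (r * x) \<partial>std_normal_distribution) = 0"
    using integral_Im[OF int] unfolding ch by (simp add: Im_exp)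
  have ic: "integrable std_normal_distribution (\<lambda>x. cos (r * x))"
    and si: "integrable std_normal_distribution (\<lambda>x. sin (r * x))"
    by (auto intro!: S.integrable_const_bound[where B=1])
  have "(\<integral>x. cos (s * x + \<theta>) \<partial>normal_law 0 v) = (\<integral>x. normal_density 0 \<sigma> x * cos (s * x + \<theta>) \<partial>lborel)"
    using v by (simp add: normal_law_def \<sigma>_def integral_density)
  also have "\<dots> = \<sigma> * (\<integral>x. normal_density 0 \<sigma> (0 + \<sigma> * x) * cos (s * (0 + \<sigma> * x) + \<theta>) \<partial>lborel)"
    using \<sigma> by (subst lborel_integral_real_affine[where c=\<sigma> and t=0]) auto
  also have "\<dots> = (\<integral>x. std_normal_density x * cos (r * x + \<theta>) \<partial>lborel)"
  proof -
    have "\<sigma> * (normal_density 0 \<sigma> (0 + \<sigma> * x) * cos (s * (0 + \<sigma> * x) + \<theta>)) =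
       std_normal_density x * cos (r * x + \<theta>)" for x
      using \<sigma>(1) by (simp add: normal_density_def r_def real_sqrt_mult power_mult_distrib mult_ac)
    then show ?thesis by (simp flip: integral_mult_right_zero)
  qed
  also have "\<dots> = (\<integral>x. cos (r * x + \<theta>) \<partial>std_normal_distribution)"
    by (simp add: integral_density)
  also have "\<dots> = exp (- r\<^sup>2 / 2) * cos \<theta>"
    using ic si by (simp add: cos_add c sn)
  also have "r\<^sup>2 = v * s\<^sup>2" using \<sigma> by (simp add: r_def power_mult_distrib)
  finally show ?thesis .
qed

section \<open>Cosine integrals and degenerate directions of Gaussian vectors\<close>

lemma gaussian_vector_psd:
  "gaussian_vector M Z \<mu> \<Sigma> \<Longrightarrow> 0 \<le> u \<bullet> (\<Sigma> *v u)"
  by (simp add: gaussian_vector_def positive_semidefinite_def)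

lemma gaussian_vector_commute:
  assumes "gaussian_vector M Z \<mu> \<Sigma>"
  shows "u \<bullet> (\<Sigma> *v w) = w \<bullet> (\<Sigma> *v u)"
  using assms by (metis gaussian_vector_def positive_semidefinite_def dot_lmul_matrix inner_commute transpose_matrix_vector)

lemma gaussian_vector_cos:
  assumes "gaussian_vector M Z 0 \<Sigma>"
  shows "(\<integral>\<omega>. cos (u \<bullet> Z \<omega> + \<theta>) \<partial>M) = exp (- (u \<bullet> (\<Sigma> *v u)) / 2) * cos \<theta>"
proof -
  have [measurable]: "Z \<in> borel_measurable M" using assms by (simp add: gaussian_vector_def)
  have "(\<integral>\<omega>. cos (u \<bullet> Z \<omega> + \<theta>) \<partial>M) = (\<integral>x. cos (1 * x + \<theta>) \<partial>distr M borel (\<lambda>\<omega>. u \<bullet> Z \<omega>))"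
    by (subst integral_distr) auto
  also have "distr M borel (\<lambda>\<omega>. u \<bullet> Z \<omega>) = normal_law 0 (u \<bullet> (\<Sigma> *v u))"
    using assms by (simp add: gaussian_vector_def)
  also have "(\<integral>x. cos (1 * x + \<theta>) \<partial>\<dots>) = exp (- (u \<bullet> (\<Sigma> *v u)) / 2) * cos \<theta>"
    using gaussian_vector_psd[OF assms] by (subst integral_normal_law_cos) auto
  finally show ?thesis .
qed

lemma gaussian_vector_AE_0:
  assumes "gaussian_vector M Z 0 \<Sigma>" "u \<bullet> (\<Sigma> *v u) = 0"
  shows "AE \<omega> in M. u \<bullet> Z \<omega> = 0"
proof -
  have [measurable]: "Z \<in> borel_measurable M" using assms by (simp add: gaussian_vector_def)
  have "distr M borel (\<lambda>\<omega>. u \<bullet> Z \<omega>) = return borel 0"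
    using assms by (simp add: gaussian_vector_def normal_law_def)
  moreover have "AE x in return borel (0::real). x = 0" by (subst AE_return) auto
  ultimately have "AE x in distr M borel (\<lambda>\<omega>. u \<bullet> Z \<omega>). x = 0" by (simp only:)
  then show ?thesis by (subst (asm) AE_distr_iff) auto
qed

lemma prob_space_normal_law: "0 \<le> v \<Longrightarrow> prob_space (normal_law \<mu> v)"
  by (auto simp: normal_law_def intro!: prob_space_return prob_space_normal_density)

lemma sets_normal_law [measurable_cong]: "sets (normal_law \<mu> v) = sets borel"
  by (simp add: normal_law_def)

context
  fixes M :: "'a measure" and Z :: "'a \<Rightarrow> real ^ 'p" and \<Sigma> :: "real ^ 'p ^ 'p" and j b :: "real ^ 'p" and q :: real
  assumes M: "prob_space M" and gv: "gaussian_vector M Z 0 \<Sigma>"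
    and q: "q = j \<bullet> (\<Sigma> *v j)" "q > 0" and b: "b = (1 / q) *\<^sub>R (\<Sigma> *v j)"
begin

interpretation prob_space M by (rule M)

text \<open>\<open>b\<close> is the regression vector of \<open>Z\<close> on
  \<open>j \<bullet> Z\<close>, so the residual is uncorrelated with \<open>j \<bullet> Z\<close>,
  and for Gaussian vectors this means independent. Both joint laws have the same cosine integrals,
  so a singular \<open>\<Sigma>\<close> causes no difficulty.\<close>

lemma gaussian_vector_residual_indep:
  "distr M (borel \<Otimes>\<^sub>M borel) (\<lambda>\<omega>. (j \<bullet> Z \<omega>, Z \<omega> - (j \<bullet> Z \<omega>) *\<^sub>R b)) =
   normal_law 0 q \<Otimes>\<^sub>M distr M borel (\<lambda>\<omega>. Z \<omega> - (j \<bullet> Z \<omega>) *\<^sub>R b)"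
proof (rule measure_eqI_inner_cos)
  have [measurable]: "Z \<in> borel_measurable M" using gv by (simp add: gaussian_vector_def)
  let ?U = "\<lambda>\<omega>. j \<bullet> Z \<omega>" and ?W = "\<lambda>\<omega>. Z \<omega> - (j \<bullet> Z \<omega>) *\<^sub>R b"
  let ?N = "normal_law 0 q" and ?D = "distr M borel ?W"
  interpret N: prob_space ?N using q by (intro prob_space_normal_law) auto
  interpret D: prob_space ?D by (rule prob_space_distr) simp
  interpret P: pair_prob_space ?N ?D ..
  show "prob_space (distr M (borel \<Otimes>\<^sub>M borel) (\<lambda>\<omega>. (?U \<omega>, ?W \<omega>)))"
    by (rule prob_space_distr) simp
  show "prob_space (?N \<Otimes>\<^sub>M ?D)" by (rule P.prob_space_axioms)
  show "sets (distr M (borel \<Otimes>\<^sub>M borel) (\<lambda>\<omega>. (?U \<omega>, ?W \<omega>))) = sets borel"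
    by (simp add: borel_prod)
  show S: "sets (?N \<Otimes>\<^sub>M ?D) = sets borel"
    by (subst borel_prod[symmetric], rule sets_pair_measure_cong) (auto simp: sets_normal_law)
  fix u :: "real \<times> (real ^ 'p)" and \<theta> :: real
  obtain a v where u: "u = (a, v)" by (cases u)
  \<comment> \<open>Testing the residual against \<open>v\<close> is testing \<open>Z\<close>
    against \<open>e\<close>. Since \<open>e\<close> is orthogonal to \<open>j\<close> for the form
    \<open>\<Sigma>\<close>, the variance in \<open>var\<close> has no cross term.\<close>
  define e where "e = v - (v \<bullet> b) *\<^sub>R j"
  have eZ: "e \<bullet> Z \<omega> = v \<bullet> ?W \<omega>" for \<omega>
    by (simp add: e_def inner_diff_left inner_diff_right)
  have ej: "e \<bullet> (\<Sigma> *v j) = 0"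
    using q by (simp add: e_def inner_diff_left b)
  have je: "j \<bullet> (\<Sigma> *v e) = 0"
    using ej gaussian_vector_commute[OF gv] by simp
  have var: "(a *\<^sub>R j + e) \<bullet> (\<Sigma> *v (a *\<^sub>R j + e)) = q * a\<^sup>2 + e \<bullet> (\<Sigma> *v e)"
    using ej je q(1)
    by (simp add: matrix_vector_right_distrib inner_add_left inner_add_right scaleR_matrix_vector_assoc[symmetric]
        matrix_vector_mult_scaleR power2_eq_square)
  have "(\<integral>x. cos (u \<bullet> x + \<theta>) \<partial>distr M (borel \<Otimes>\<^sub>M borel) (\<lambda>\<omega>. (?U \<omega>, ?W \<omega>))) =
    (\<integral>\<omega>. cos (u \<bullet> (?U \<omega>, ?W \<omega>) + \<theta>) \<partial>M)"
    by (subst integral_distr) (auto simp: borel_prod)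
  also have "\<dots> = (\<integral>\<omega>. cos ((a *\<^sub>R j + e) \<bullet> Z \<omega> + \<theta>) \<partial>M)"
    by (simp add: u inner_add_left eZ)
  also have "\<dots> = exp (- (q * a\<^sup>2) / 2) * (exp (- (e \<bullet> (\<Sigma> *v e)) / 2) * cos \<theta>)"
    by (simp add: gaussian_vector_cos[OF gv] var mult_exp_exp add_divide_distrib diff_divide_distrib)
  also have "\<dots> = exp (- (q * a\<^sup>2) / 2) * (\<integral>\<omega>. cos (e \<bullet> Z \<omega> + \<theta>) \<partial>M)"
    by (simp add: gaussian_vector_cos[OF gv])
  also have "\<dots> = exp (- (q * a\<^sup>2) / 2) * (\<integral>w. cos (v \<bullet> w + \<theta>) \<partial>?D)"
    by (subst integral_distr) (auto simp: eZ)
  also have "\<dots> = (\<integral>w. (\<integral>x. cos (a * x + (v \<bullet> w + \<theta>)) \<partial>?N) \<partial>?D)"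
    using q by (simp add: integral_normal_law_cos)
  also have "\<dots> = (\<integral>x. cos (u \<bullet> x + \<theta>) \<partial>(?N \<Otimes>\<^sub>M ?D))"
  proof -
    have m: "(\<lambda>x. cos (u \<bullet> x + \<theta>)) \<in> borel_measurable (?N \<Otimes>\<^sub>M ?D)"
      using S by (subst measurable_cong_sets[of _ borel _ borel]) auto
    have "integrable (?N \<Otimes>\<^sub>M ?D) (\<lambda>x. cos (u \<bullet> x + \<theta>))"
      using m by (intro P.integrable_const_bound[where B=1]) auto
    then have "integrable (?N \<Otimes>\<^sub>M ?D) (\<lambda>(x, w). cos (u \<bullet> (x, w) + \<theta>))"
      by (simp only: case_prod_beta' prod.collapse)
    from P.integral_snd[OF this]
    have "(\<integral>w. (\<integral>x. cos (u \<bullet> (x, w) + \<theta>) \<partial>?N) \<partial>?D) = (\<integral>x. cos (u \<bullet> x + \<theta>) \<partial>(?N \<Otimes>\<^sub>M ?D))"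
      by (simp only: case_prod_beta' prod.collapse)
    then show ?thesis by (simp add: u add.assoc)
  qed
  finally show "(\<integral>x. cos (u \<bullet> x + \<theta>) \<partial>distr M (borel \<Otimes>\<^sub>M borel) (\<lambda>\<omega>. (?U \<omega>, ?W \<omega>))) =
    (\<integral>x. cos (u \<bullet> x + \<theta>) \<partial>(?N \<Otimes>\<^sub>M ?D))" .
qed

text \<open>Fubini for the independent pair: fixing \<open>j \<bullet> Z\<close> at \<open>x\<close>
  leaves the law of the residual unchanged. All later conditioning goes through this
  formula.\<close>

lemma gaussian_vector_residual_emeasure:
  assumes C: "C \<in> sets (borel \<Otimes>\<^sub>M borel)"
  shows "emeasure M {\<omega>\<in>space M. (j \<bullet> Z \<omega>, Z \<omega> - (j \<bullet> Z \<omega>) *\<^sub>R b) \<in> C} =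
    (\<integral>\<^sup>+x. ennreal (normal_density 0 (sqrt q) x) *
       emeasure M {\<omega>\<in>space M. (x, Z \<omega> - (j \<bullet> Z \<omega>) *\<^sub>R b) \<in> C} \<partial>lborel)"
proof -
  have [measurable]: "Z \<in> borel_measurable M" using gv by (simp add: gaussian_vector_def)
  note C[measurable]
  let ?W = "\<lambda>\<omega>. Z \<omega> - (j \<bullet> Z \<omega>) *\<^sub>R b"
  let ?D = "distr M borel ?W"
  interpret D: prob_space ?D by (rule prob_space_distr) simp
  have C': "C \<in> sets (normal_law 0 q \<Otimes>\<^sub>M ?D)"
    using C by (simp add: sets_normal_law cong: sets_pair_measure_cong)
  have meas: "(\<lambda>x. emeasure ?D (Pair x -` C)) \<in> borel_measurable borel"
    using D.measurable_emeasure_Pair[of C borel] C by (simp cong: sets_pair_measure_cong)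
  have "emeasure M {\<omega>\<in>space M. (j \<bullet> Z \<omega>, ?W \<omega>) \<in> C} =
    emeasure (distr M (borel \<Otimes>\<^sub>M borel) (\<lambda>\<omega>. (j \<bullet> Z \<omega>, ?W \<omega>))) C"
    by (subst emeasure_distr) (auto intro!: arg_cong[where f="emeasure M"])
  also have "\<dots> = (\<integral>\<^sup>+x. emeasure ?D (Pair x -` C) \<partial>normal_law 0 q)"
    unfolding gaussian_vector_residual_indep by (rule D.emeasure_pair_measure_alt[OF C'])
  also have "\<dots> = (\<integral>\<^sup>+x. ennreal (normal_density 0 (sqrt q) x) * emeasure ?D (Pair x -` C) \<partial>lborel)"
    using q(2) meas by (simp add: normal_law_def nn_integral_density)
  also have "\<dots> = (\<integral>\<^sup>+x. ennreal (normal_density 0 (sqrt q) x) *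
       emeasure M {\<omega>\<in>space M. (x, ?W \<omega>) \<in> C} \<partial>lborel)"
    by (intro nn_integral_cong arg_cong2[where f="(*)"] refl, subst emeasure_distr)
       (auto intro!: arg_cong[where f="emeasure M"])
  finally show ?thesis .
qed

end

section \<open>Normal tails and one-sided averages\<close>

lemma normal_density_0_eq:
  "0 < \<sigma> \<Longrightarrow> normal_density 0 \<sigma> x = exp (- x\<^sup>2 / (2 * \<sigma>\<^sup>2)) / (\<sigma> * sqrt (2 * pi))"
  by (simp add: normal_density_def real_sqrt_mult)

text \<open>The Mills ratio bound
  \<open>\<sigma>^2 * n t / t \<le> (1 + \<sigma>^2 / t^2) * I\<close>, with \<open>I\<close> the
  tail integral, multiplied by \<open>t^2 / \<sigma>^2\<close>.\<close>

lemma normal_tail_lower_bound: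
  assumes \<sigma>: "0 < \<sigma>" and t: "0 < (t::real)"
  shows "ennreal (t * normal_density 0 \<sigma> t) \<le>
    ennreal (t\<^sup>2 / \<sigma>\<^sup>2 + 1) * (\<integral>\<^sup>+x. ennreal (normal_density 0 \<sigma> x) * indicator {t<..} x \<partial>lborel)"
proof -
  define n where "n = normal_density 0 \<sigma>"
  let ?I = "\<integral>\<^sup>+x. ennreal (n x) * indicator {t<..} x \<partial>lborel"
  have n0: "0 \<le> n x" for x by (simp add: n_def)
  have [measurable]: "n \<in> borel_measurable borel" by (simp add: n_def)
  \<comment> \<open>An antiderivative of \<open>f\<close>, which exceeds \<open>n\<close> by a
    factor of at most \<open>1 + \<sigma>^2 / t^2\<close> beyond \<open>t\<close>. As
    \<open>F\<close> vanishes at infinity, the integral of \<open>f\<close> over the half-line is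
    \<open>- F t\<close>.\<close>
  define F where "F x = - (\<sigma>\<^sup>2 * n x / x)" for x
  define f where "f x = n x * (1 + \<sigma>\<^sup>2 / x\<^sup>2)" for x
  have [measurable]: "f \<in> borel_measurable borel" unfolding f_def by measurable
  have dn: "DERIV n x :> - (x / \<sigma>\<^sup>2) * n x" for x
    unfolding n_def normal_density_0_eq[OF \<sigma>, abs_def] using \<sigma>
    by (auto intro!: derivative_eq_intros simp: field_simps power2_eq_square)
  have dF: "DERIV F x :> f x" if "t \<le> x" for x
  proof -
    have "x \<noteq> 0" using that t by simp
    then show ?thesis unfolding F_def f_def using \<sigma>
      by (auto intro!: derivative_eq_intros dn simp: field_simps power2_eq_square)
  qed
  have lim: "(F \<longlongrightarrow> 0) at_top"
  proof (rule Lim_null_comparison[where g="\<lambda>x. \<sigma>\<^sup>2 * (1 / (\<sigma> * sqrt (2 * pi))) / x"])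
    have "norm (F x) \<le> \<sigma>\<^sup>2 * (1 / (\<sigma> * sqrt (2 * pi))) / x" if "x > 0" for x
    proof -
      have "n x \<le> 1 / (\<sigma> * sqrt (2 * pi))"
        unfolding n_def normal_density_0_eq[OF \<sigma>] using \<sigma> by (intro divide_right_mono) auto
      then have "\<sigma>\<^sup>2 * n x / x \<le> \<sigma>\<^sup>2 * (1 / (\<sigma> * sqrt (2 * pi))) / x"
        using that by (intro divide_right_mono mult_left_mono) auto
      then show ?thesis using that n0[of x] by (simp add: F_def abs_mult)
    qed
    then show "\<forall>\<^sub>F x in at_top. norm (F x) \<le> \<sigma>\<^sup>2 * (1 / (\<sigma> * sqrt (2 * pi))) / x"
      by (rule eventually_mono[OF eventually_gt_at_top[of 0]])
    show "((\<lambda>x. \<sigma>\<^sup>2 * (1 / (\<sigma> * sqrt (2 * pi))) / x) \<longlongrightarrow> 0) at_top"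
      by (rule tendsto_divide_0[OF tendsto_const]) (rule filterlim_at_top_imp_at_infinity[OF filterlim_ident])
  qed
  have "ennreal (\<sigma>\<^sup>2 * n t / t) = (\<integral>\<^sup>+x. ennreal (f x) * indicator {t..} x \<partial>lborel)"
    using nn_integral_FTC_atLeast[OF _ dF _ lim] n0 by (simp add: F_def f_def)
  also have "\<dots> \<le> (\<integral>\<^sup>+x. ennreal (1 + \<sigma>\<^sup>2 / t\<^sup>2) * (ennreal (n x) * indicator {t<..} x) \<partial>lborel)"
  proof (rule nn_integral_mono_AE)
    have "AE x in lborel. x \<noteq> t" by (rule AE_lborel_singleton)
    then show "AE x in lborel. ennreal (f x) * indicator {t..} x \<le> ennreal (1 + \<sigma>\<^sup>2 / t\<^sup>2) * (ennreal (n x) * indicator {t<..} x)"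
    proof (rule AE_mp, intro AE_I2 impI)
      fix x :: real assume "x \<noteq> t"
      show "ennreal (f x) * indicator {t..} x \<le> ennreal (1 + \<sigma>\<^sup>2 / t\<^sup>2) * (ennreal (n x) * indicator {t<..} x)"
      proof (cases "t < x")
        case True
        then have "\<sigma>\<^sup>2 / x\<^sup>2 \<le> \<sigma>\<^sup>2 / t\<^sup>2" using t \<sigma> by (intro divide_left_mono power_mono) auto
        then have "f x \<le> (1 + \<sigma>\<^sup>2 / t\<^sup>2) * n x"
          unfolding f_def using n0[of x] by (metis add_left_mono mult.commute mult_left_mono)
        then have "ennreal (f x) \<le> ennreal (1 + \<sigma>\<^sup>2 / t\<^sup>2) * ennreal (n x)"
          using n0[of x] by (subst ennreal_mult[symmetric]) (auto intro!: ennreal_leI)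
        then show ?thesis using True by simp
      qed (use \<open>x \<noteq> t\<close> in auto)
    qed
  qed
  also have "\<dots> = ennreal (1 + \<sigma>\<^sup>2 / t\<^sup>2) * ?I" by (rule nn_integral_cmult) measurable
  finally have "ennreal (t\<^sup>2 / \<sigma>\<^sup>2) * ennreal (\<sigma>\<^sup>2 * n t / t) \<le> ennreal (t\<^sup>2 / \<sigma>\<^sup>2) * (ennreal (1 + \<sigma>\<^sup>2 / t\<^sup>2) * ?I)"
    by (rule mult_left_mono) simp
  moreover have "ennreal (t\<^sup>2 / \<sigma>\<^sup>2) * ennreal (\<sigma>\<^sup>2 * n t / t) = ennreal (t * n t)"
    using \<sigma> t n0[of t] by (subst ennreal_mult[symmetric]) (auto simp: field_simps power2_eq_square)
  moreover have "ennreal (t\<^sup>2 / \<sigma>\<^sup>2) * (ennreal (1 + \<sigma>\<^sup>2 / t\<^sup>2) * ?I) = ennreal (t\<^sup>2 / \<sigma>\<^sup>2 + 1) * ?I"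
  proof -
    have "ennreal (t\<^sup>2 / \<sigma>\<^sup>2) * ennreal (1 + \<sigma>\<^sup>2 / t\<^sup>2) = ennreal (t\<^sup>2 / \<sigma>\<^sup>2 + 1)"
      using \<sigma> t by (subst ennreal_mult[symmetric]) (auto simp: field_simps)
    then show ?thesis by (simp only: mult.assoc[symmetric])
  qed
  ultimately show ?thesis by (simp add: n_def)
qed

text \<open>In the variable \<open>y = t / \<sigma>\<close> this is the decrease of
  \<open>y * exp (- y^2 / 2)\<close> beyond \<open>1\<close>. It follows from
  \<open>y \<le> K * (1 + (y - K)) \<le> K * exp (y - K)\<close> and
  \<open>y - K \<le> (y^2 - K^2) / 2\<close>.\<close>

lemma mult_normal_density_le_of_large:
  assumes \<sigma>: "0 < \<sigma>" and K: "1 \<le> K" and t: "K \<le> t / \<sigma>"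
  shows "t * normal_density 0 \<sigma> t \<le> K * exp (- K\<^sup>2 / 2) / sqrt (2 * pi)"
proof -
  define y where "y = t / \<sigma>"
  have y: "K \<le> y" "t = y * \<sigma>" using t \<sigma> by (auto simp: y_def)
  have "y \<le> K * (1 + (y - K))"
  proof -
    have "(K - 1) * (y - K) \<ge> 0" using K y by simp
    then show ?thesis by (simp add: algebra_simps)
  qed
  also have "\<dots> \<le> K * exp (y - K)"
    using K exp_ge_add_one_self by (intro mult_left_mono) auto
  also have "\<dots> \<le> K * exp ((y\<^sup>2 - K\<^sup>2) / 2)"
  proof -
    have "(y - K) * 2 \<le> (y - K) * (y + K)" using K y by (intro mult_left_mono) auto
    then have "y - K \<le> (y\<^sup>2 - K\<^sup>2) / 2" by (simp add: power2_eq_square algebra_simps)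
    then show ?thesis using K by simp
  qed
  finally have "y * exp (- y\<^sup>2 / 2) \<le> K * exp ((y\<^sup>2 - K\<^sup>2) / 2) * exp (- y\<^sup>2 / 2)"
    by (rule mult_right_mono) simp
  also have "\<dots> = K * exp (- K\<^sup>2 / 2)"
    by (simp add: mult.assoc mult_exp_exp diff_divide_distrib)
  finally have "y * exp (- y\<^sup>2 / 2) / sqrt (2 * pi) \<le> K * exp (- K\<^sup>2 / 2) / sqrt (2 * pi)"
    by (rule divide_right_mono) simp
  moreover have "t * normal_density 0 \<sigma> t = y * exp (- y\<^sup>2 / 2) / sqrt (2 * pi)"
    using \<sigma> by (simp add: normal_density_0_eq y(2) power_mult_distrib)
  ultimately show ?thesis by simp
qed

text \<open>Near \<open>t\<close> on the right \<open>h\<close> lies within \<open>e / 2\<close> of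
  \<open>l\<close>, hence so does its average. The value \<open>h t\<close> is irrelevant because a
  single point is a null set.\<close>

lemma tendsto_right_average:
  fixes h :: "real \<Rightarrow> real"
  assumes [measurable]: "h \<in> borel_measurable borel" and h0: "\<And>x. 0 \<le> h x"
    and lim: "(h \<longlongrightarrow> l) (at_right t)"
  shows "((\<lambda>\<delta>. 1 / \<delta> * enn2real (\<integral>\<^sup>+x. ennreal (h x) * indicator {t..<t + \<delta>} x \<partial>lborel)) \<longlongrightarrow> l) (at_right 0)"
proof (rule tendstoI)
  fix e :: real assume e: "0 < e"
  have l0: "0 \<le> l" using lim by (rule tendsto_lowerbound) (auto simp: h0)
  have "eventually (\<lambda>x. dist (h x) l < e / 2) (at_right t)" using lim e by (intro tendstoD) auto
  then obtain d where d: "d > t" "\<And>x. t < x \<Longrightarrow> x < d \<Longrightarrow> dist (h x) l < e / 2"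
    by (auto simp: eventually_at_right_field)
  have "eventually (\<lambda>\<delta>. \<delta> \<in> {0<..<d - t}) (at_right 0)"
    using d by (intro eventually_at_right_real) auto
  then show "\<forall>\<^sub>F \<delta> in at_right 0. dist (1 / \<delta> * enn2real (\<integral>\<^sup>+x. ennreal (h x) * indicator {t..<t + \<delta>} x \<partial>lborel)) l < e"
  proof eventually_elim
    fix \<delta> assume \<delta>: "\<delta> \<in> {0<..<d - t}"
    define I where "I = (\<integral>\<^sup>+x. ennreal (h x) * indicator {t..<t + \<delta>} x \<partial>lborel)"
    have const: "(\<integral>\<^sup>+x. ennreal c * indicator {t..<t + \<delta>} x \<partial>lborel) = ennreal (c * \<delta>)" if "0 \<le> c" for c
      using \<delta> that by (subst nn_integral_cmult_indicator) (auto simp: ennreal_mult)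
    \<comment> \<open>The lower bound is clamped at \<open>0\<close> so that \<open>const\<close>
      applies to it.\<close>
    have hb: "max 0 (l - e / 2) \<le> h x" "h x \<le> l + e / 2" if "t < x" "x < t + \<delta>" for x
    proof -
      have "\<bar>h x - l\<bar> < e / 2" using d(2)[of x] that \<delta> by (simp add: dist_real_def)
      then show "max 0 (l - e / 2) \<le> h x" "h x \<le> l + e / 2"
        using h0[of x] unfolding max_def abs_less_iff by auto
    qed
    have ne: "AE x in lborel. x \<noteq> t" by (rule AE_lborel_singleton)
    have "I \<le> (\<integral>\<^sup>+x. ennreal (l + e / 2) * indicator {t..<t + \<delta>} x \<partial>lborel)"
      unfolding I_def using ne by (intro nn_integral_mono_AE)
        (auto simp: indicator_def intro!: ennreal_leI hb)
    then have up: "I \<le> ennreal ((l + e / 2) * \<delta>)" using l0 e by (simp only: const add_nonneg_nonneg less_imp_le half_gt_zero)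
    have "(\<integral>\<^sup>+x. ennreal (max 0 (l - e / 2)) * indicator {t..<t + \<delta>} x \<partial>lborel) \<le> I"
      unfolding I_def using ne by (intro nn_integral_mono_AE)
        (use hb in \<open>auto simp: indicator_def intro!: ennreal_leI\<close>)
    then have lo: "ennreal (max 0 (l - e / 2) * \<delta>) \<le> I" by (simp only: const max.cobounded1)
    have fin: "I < \<infinity>" using up by (simp add: le_less_trans)
    have "enn2real I \<le> (l + e / 2) * \<delta>"
      using up l0 e \<delta> by (auto intro!: enn2real_leI)
    moreover have "max 0 (l - e / 2) * \<delta> \<le> enn2real I"
      using enn2real_mono[OF lo] fin \<delta> by simp
    then have "(l - e / 2) * \<delta> \<le> enn2real I"
      using \<delta> by (meson greaterThanLessThan_iff less_imp_le max.cobounded2 mult_right_mono order_trans)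
    ultimately have "1 / \<delta> * enn2real I \<le> l + e / 2" "l - e / 2 \<le> 1 / \<delta> * enn2real I"
      using \<delta> by (auto simp: field_simps)
    then show "dist (1 / \<delta> * enn2real I) l < e" using e by (auto simp: dist_real_def)
  qed
qed

text \<open>The choice of \<open>K\<close> makes \<open>n * exp (- K^2 / 2)\<close> equal to
  \<open>exp 1\<close>, so \<open>n\<close> terms together cost only a multiple of \<open>K\<close>.
  As \<open>4 * ln n = 2 * K^2 + 4\<close>, a quadratic inequality in \<open>K\<close>
  remains.\<close>

lemma log_bound_aux:
  fixes n :: real
  assumes n: "6 \<le> n"
  defines "K \<equiv> sqrt (2 * ln n - 2)"
  shows "1 \<le> K" "exp (1/2) * ((K\<^sup>2 + 1) + n * (K * exp (- K\<^sup>2 / 2) / sqrt (2 * pi))) \<le> 4 * ln n"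
proof -
  have e1: "exp 1 \<le> (2.7183 :: real)" "exp 1 \<ge> (2.7182::real)"
    using e_approx_32 by (auto simp: abs_if split: if_splits)
  \<comment> \<open>From \<open>n \<ge> 6\<close> follows \<open>ln n \<ge> 3/2\<close>, which is
    exactly \<open>K \<ge> 1\<close>.\<close>
  have "exp (3/2) ^ 2 = exp (1::real) ^ 3" by (simp flip: exp_of_nat_mult)
  also have "\<dots> \<le> 2.7183 ^ 3" using e1 by (intro power_mono) auto
  also have "\<dots> \<le> (6::real)\<^sup>2" by (simp add: power2_eq_square power3_eq_cube)
  finally have "exp (3/2) \<le> (6::real)" by (rule power2_le_imp_le) simp
  then have "ln (exp (3/2)) \<le> ln n" using n by (subst ln_le_cancel_iff) auto
  then have ln: "3/2 \<le> ln n" by simp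
  have K2: "K\<^sup>2 = 2 * ln n - 2" using ln by (simp add: K_def)
  show K1: "1 \<le> K" using ln by (simp add: K_def)
  have "exp (- K\<^sup>2 / 2) = exp 1 / n"
    using n by (simp add: K2 exp_diff diff_divide_distrib)
  then have eK: "n * (K * exp (- K\<^sup>2 / 2) / sqrt (2 * pi)) = K * (exp 1 / sqrt (2 * pi))"
    using n by simp
  define c where "c = exp (1/2 :: real)"
  have "c\<^sup>2 = exp 1" by (simp add: c_def flip: exp_of_nat_mult)
  then have "c\<^sup>2 \<le> (2061/1250)\<^sup>2" using e1 by (simp add: power2_eq_square)
  then have c: "c \<le> (2061/1250)" by (rule power2_le_imp_le) simp
  define d where "d = c * (exp 1 / sqrt (2 * pi))"
  have "d\<^sup>2 = exp 1 ^ 3 / (2 * pi)"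
    using \<open>c\<^sup>2 = exp 1\<close> by (simp add: d_def power_mult_distrib power_divide power3_eq_cube power2_eq_square)
  also have "\<dots> \<le> 2.7183 ^ 3 / (2 * 3.14)"
    using e1 pi_approx by (intro frac_le power_mono mult_left_mono) auto
  also have "\<dots> \<le> (179/100)\<^sup>2" by (simp add: power2_eq_square power3_eq_cube)
  finally have d: "d \<le> (179/100)" by (rule power2_le_imp_le) simp
  have "c * ((K\<^sup>2 + 1) + K * (exp 1 / sqrt (2 * pi))) = c * (K\<^sup>2 + 1) + d * K"
    by (simp add: d_def algebra_simps)
  also have "\<dots> \<le> (2061/1250) * (K\<^sup>2 + 1) + (179/100) * K"
    using c d K1 by (intro add_mono mult_right_mono) auto
  also have "\<dots> \<le> 2 * K\<^sup>2 + 4"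
  proof -
    \<comment> \<open>The difference of the two sides is
      \<open>0.3512 * K^2 - 1.79 * K + 2.3512\<close>. This square lies just below it for
      \<open>K \<ge> 0\<close>.\<close>
    have "0 \<le> 7 / 20 * (K - 64 / 25)\<^sup>2" by simp
    then have "0 \<le> 7 / 20 * K\<^sup>2 - 224 / 125 * K + 7168 / 3125"
      by (simp add: power2_eq_square algebra_simps)
    then show ?thesis using K1 zero_le_power2[of K] by (simp add: field_simps)
  qed
  also have "\<dots> = 4 * ln n" by (simp add: K2)
  finally show "exp (1/2) * ((K\<^sup>2 + 1) + n * (K * exp (- K\<^sup>2 / 2) / sqrt (2 * pi))) \<le> 4 * ln n"
    unfolding eK c_def .
qed

section \<open>The right density of a maximum of Gaussians\<close>

text \<open>A strict inequality at \<open>t\<close> persists by continuity; in case of equality the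
  sign of the slope \<open>m\<close> decides.\<close>

lemma eventually_at_right_le_mult_iff:
  fixes a m t :: real
  shows "eventually (\<lambda>x. a \<le> m * x \<longleftrightarrow> a < m * t \<or> a = m * t \<and> 0 \<le> m) (at_right t)"
    and "eventually (\<lambda>x. a < m * x \<longleftrightarrow> a < m * t \<or> a = m * t \<and> 0 < m) (at_right t)"
proof -
  have lim: "((\<lambda>x. m * x) \<longlongrightarrow> m * t) (at_right t)" by (intro tendsto_intros)
  have gt: "eventually (\<lambda>x. t < x) (at_right t)" by (rule eventually_at_right_less)
  consider "a < m * t" | "a = m * t" | "m * t < a" by linarith
  then have "eventually (\<lambda>x. (a \<le> m * x \<longleftrightarrow> a < m * t \<or> a = m * t \<and> 0 \<le> m) \<and>
      (a < m * x \<longleftrightarrow> a < m * t \<or> a = m * t \<and> 0 < m)) (at_right t)"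
  proof cases
    case 1
    show ?thesis using order_tendstoD(1)[OF lim 1] by eventually_elim (use 1 in auto)
  next
    case 2
    show ?thesis using gt
    proof eventually_elim
      case (elim x)
      then show ?case unfolding 2 by (auto simp: mult_le_cancel_left mult_less_cancel_left)
    qed
  next
    case 3
    show ?thesis using order_tendstoD(2)[OF lim 3] by eventually_elim (use 3 in auto)
  qed
  then show "eventually (\<lambda>x. a \<le> m * x \<longleftrightarrow> a < m * t \<or> a = m * t \<and> 0 \<le> m) (at_right t)"
    and "eventually (\<lambda>x. a < m * x \<longleftrightarrow> a < m * t \<or> a = m * t \<and> 0 < m) (at_right t)"
    by (auto elim: eventually_mono)
qed

text \<open>Along every sequence decreasing to \<open>t\<close> the indicators are pointwise
  eventually constant, so dominated convergence applies.\<close>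

lemma (in prob_space) tendsto_prob_at_right:
  fixes t :: real
  assumes A: "\<And>x. A x \<in> events" and B: "B \<in> events"
    and ev: "\<And>\<omega>. \<omega> \<in> space M \<Longrightarrow> eventually (\<lambda>x. \<omega> \<in> A x \<longleftrightarrow> \<omega> \<in> B) (at_right t)"
  shows "((\<lambda>x. prob (A x)) \<longlongrightarrow> prob B) (at_right t)"
  unfolding tendsto_at_iff_sequentially comp_def
proof (intro allI impI)
  fix X :: "nat \<Rightarrow> real" assume X: "\<forall>i. X i \<in> {t<..} - {t}" "X \<longlonglongrightarrow> t"
  then have fl: "filterlim X (at_right t) sequentially"
    by (auto simp: filterlim_at intro!: always_eventually dest: spec less_imp_neq)
  have "(\<lambda>i. \<integral>\<omega>. indicator (A (X i)) \<omega> \<partial>M :: real) \<longlonglongrightarrow> (\<integral>\<omega>. indicator B \<omega> \<partial>M)"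
  proof (rule integral_dominated_convergence[where w="\<lambda>_. 1"])
    show "AE \<omega> in M. (\<lambda>i. indicator (A (X i)) \<omega> :: real) \<longlonglongrightarrow> indicator B \<omega>"
    proof (rule AE_I2)
      fix \<omega> assume "\<omega> \<in> space M"
      have "eventually (\<lambda>i. \<omega> \<in> A (X i) \<longleftrightarrow> \<omega> \<in> B) sequentially"
        using eventually_compose_filterlim[OF ev[OF \<open>\<omega> \<in> space M\<close>] fl] .
      then have "eventually (\<lambda>i. indicator (A (X i)) \<omega> = (indicator B \<omega> :: real)) sequentially"
        by eventually_elim (simp add: indicator_def)
      then show "(\<lambda>i. indicator (A (X i)) \<omega> :: real) \<longlonglongrightarrow> indicator B \<omega>"
        by (rule tendsto_eventually)
    qed
  qed (use A B in \<open>auto simp: indicator_def\<close>)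
  then show "(\<lambda>i. prob (A (X i))) \<longlonglongrightarrow> prob B"
    using A B by simp
qed

text \<open>\<open>J\<close> is a finite set of non-degenerate linear functionals whose maximum is
  studied. The injective rank \<open>r\<close> breaks ties, so that exactly one of them counts as
  the maximiser.\<close>

locale ranked_gaussian_family = prob_space M
  for M :: "'a measure" and Z :: "'a \<Rightarrow> real ^ 'p" and \<Sigma> :: "real ^ 'p ^ 'p"
    and J :: "(real ^ 'p) set" and r :: "real ^ 'p \<Rightarrow> nat" +
  assumes gv: "gaussian_vector M Z 0 \<Sigma>"
    and J: "finite J" "J \<noteq> {}" "\<And>j. j \<in> J \<Longrightarrow> 0 < j \<bullet> (\<Sigma> *v j)"
    and r: "inj_on r J"
begin

definition q :: "real ^ 'p \<Rightarrow> real" where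
  "q j = j \<bullet> (\<Sigma> *v j)"

text \<open>The regression vector of \<open>Z\<close> on \<open>j \<bullet> Z\<close>, which makes
  \<open>W j\<close> independent of \<open>j \<bullet> Z\<close>.\<close>

definition \<beta> :: "real ^ 'p \<Rightarrow> real ^ 'p" where
  "\<beta> j = (1 / q j) *\<^sub>R (\<Sigma> *v j)"

definition W :: "real ^ 'p \<Rightarrow> 'a \<Rightarrow> real ^ 'p" where
  "W j \<omega> = Z \<omega> - (j \<bullet> Z \<omega>) *\<^sub>R \<beta> j"

text \<open>Given \<open>j \<bullet> Z = x\<close> and the residual \<open>w = W j\<close>, this says that \<open>j\<close> beats \<open>k\<close>; ties are broken
  in favour of the smaller rank \<open>r\<close>.\<close>

definition beats :: "real ^ 'p \<Rightarrow> real \<Rightarrow> real ^ 'p \<Rightarrow> real ^ 'p \<Rightarrow> bool" where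
  "beats j x w k = (if r k < r j then k \<bullet> w < (1 - k \<bullet> \<beta> j) * x else k \<bullet> w \<le> (1 - k \<bullet> \<beta> j) * x)"

text \<open>The eventual truth value of \<^term>\<open>beats j x w k\<close> as \<open>x\<close> decreases to \<open>t\<close>.\<close>

definition beats_right :: "real ^ 'p \<Rightarrow> real \<Rightarrow> real ^ 'p \<Rightarrow> real ^ 'p \<Rightarrow> bool" where
  "beats_right j t w k \<longleftrightarrow> k \<bullet> w < (1 - k \<bullet> \<beta> j) * t \<or>
     k \<bullet> w = (1 - k \<bullet> \<beta> j) * t \<and> (if r k < r j then 0 < 1 - k \<bullet> \<beta> j else 0 \<le> 1 - k \<bullet> \<beta> j)"

text \<open>Only the residual is random here, with \<open>x\<close> in place of
  \<open>j \<bullet> Z\<close>. By independence the probability of this event is a version of the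
  conditional probability that \<open>j\<close> attains the maximum given
  \<open>j \<bullet> Z = x\<close>.\<close>

definition wins :: "real ^ 'p \<Rightarrow> real \<Rightarrow> 'a set" where
  "wins j x = {\<omega>\<in>space M. \<forall>k\<in>J - {j}. beats j x (W j \<omega>) k}"

definition wins_right :: "real ^ 'p \<Rightarrow> real \<Rightarrow> 'a set" where
  "wins_right j t = {\<omega>\<in>space M. \<forall>k\<in>J - {j}. beats_right j t (W j \<omega>) k}"

section \<open>Measurability and right limits of the winning events\<close>

lemma Z_measurable [measurable]: "Z \<in> borel_measurable M"
  using gv by (simp add: gaussian_vector_def)

lemma W_measurable [measurable]: "W j \<in> borel_measurable M"
  unfolding W_def by measurable

lemma finJ [simp, intro]: "finite (J - {j})"
  using J by simp

lemma beats_measurable [measurable (raw)]: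
  assumes [measurable]: "f \<in> borel_measurable N" "g \<in> borel_measurable N"
  shows "Measurable.pred N (\<lambda>x. beats j (f x) (g x) k)"
proof (cases "r k < r j")
  case True
  then show ?thesis by (simp add: beats_def)
next
  case False
  then show ?thesis by (simp add: beats_def)
qed

lemma beats_right_measurable [measurable (raw)]:
  assumes [measurable]: "g \<in> borel_measurable N"
  shows "Measurable.pred N (\<lambda>x. beats_right j t (g x) k)"
proof (cases "r k < r j")
  case True
  then show ?thesis by (simp add: beats_right_def)
next
  case False
  then show ?thesis by (simp add: beats_right_def)
qed

lemma wins_events [measurable]: "wins j x \<in> events"
  unfolding wins_def by (rule sets.sets_Collect_finite_All[OF _ finJ]) measurable

lemma wins_right_events [measurable]: "wins_right j t \<in> events"
  unfolding wins_right_def by (rule sets.sets_Collect_finite_All[OF _ finJ]) measurable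

lemma eventually_beats:
  "eventually (\<lambda>x. beats j x w k \<longleftrightarrow> beats_right j t w k) (at_right t)"
  unfolding beats_def beats_right_def
  using eventually_at_right_le_mult_iff[of "k \<bullet> w" "1 - k \<bullet> \<beta> j" t] by simp

lemma tendsto_prob_wins:
  "((\<lambda>x. prob (wins j x)) \<longlongrightarrow> prob (wins_right j t)) (at_right t)"
proof (rule tendsto_prob_at_right)
  fix \<omega> assume "\<omega> \<in> space M"
  have "eventually (\<lambda>x. \<forall>k\<in>J - {j}. beats j x (W j \<omega>) k \<longleftrightarrow> beats_right j t (W j \<omega>) k) (at_right t)"
    by (intro eventually_ball_finite ballI eventually_beats finJ)
  then show "eventually (\<lambda>x. \<omega> \<in> wins j x \<longleftrightarrow> \<omega> \<in> wins_right j t) (at_right t)"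
    by eventually_elim (auto simp: wins_def wins_right_def)
qed simp_all

section \<open>Decomposition of the maximum into faces\<close>

lemma beats_iff:
  "beats j (j \<bullet> Z \<omega>) (W j \<omega>) k \<longleftrightarrow> (if r k < r j then k \<bullet> Z \<omega> < j \<bullet> Z \<omega> else k \<bullet> Z \<omega> \<le> j \<bullet> Z \<omega>)"
  by (auto simp: beats_def W_def inner_diff_right algebra_simps)

lemma emeasure_joint:
  assumes "j \<in> J" "C \<in> sets (borel \<Otimes>\<^sub>M borel)"
  shows "emeasure M {\<omega>\<in>space M. (j \<bullet> Z \<omega>, W j \<omega>) \<in> C} =
    (\<integral>\<^sup>+x. ennreal (normal_density 0 (sqrt (q j)) x) * emeasure M {\<omega>\<in>space M. (x, W j \<omega>) \<in> C} \<partial>lborel)"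
  using gaussian_vector_residual_emeasure[OF prob_space_axioms gv q_def _ \<beta>_def assms(2)] J(3)[OF assms(1)]
  unfolding W_def q_def by simp

lemma C_sets: "{z. \<forall>k\<in>J - {j}. beats j (fst z) (snd z) k} \<in> sets (borel \<Otimes>\<^sub>M borel)"
proof -
  have "{z \<in> space (borel \<Otimes>\<^sub>M borel). \<forall>k\<in>J - {j}. beats j (fst z) (snd z) k} \<in> sets (borel \<Otimes>\<^sub>M borel)"
    by (rule sets.sets_Collect_finite_All[OF _ finJ]) measurable
  then show ?thesis by (simp add: space_pair_measure)
qed

lemma prob_wins_measurable [measurable]: "(\<lambda>x. prob (wins j x)) \<in> borel_measurable borel"
proof -
  let ?C = "{z. \<forall>k\<in>J - {j}. beats j (fst z) (snd z) k}"
  let ?D = "distr M borel (W j)"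
  interpret D: prob_space ?D by (rule prob_space_distr) simp
  have "(\<lambda>x. emeasure ?D (Pair x -` ?C)) \<in> borel_measurable borel"
    using D.measurable_emeasure_Pair[of ?C borel] C_sets by (simp cong: sets_pair_measure_cong)
  moreover have "emeasure ?D (Pair x -` ?C) = emeasure M (wins j x)" for x
    using sets_Pair1[OF C_sets]
    by (subst emeasure_distr) (auto simp: wins_def intro!: arg_cong[where f="emeasure M"])
  ultimately have "(\<lambda>x. emeasure M (wins j x)) \<in> borel_measurable borel" by simp
  then show ?thesis unfolding measure_def by measurable
qed

lemma prob_face:
  assumes "j \<in> J"
  shows "emeasure M {\<omega>\<in>space M. t \<le> j \<bullet> Z \<omega> \<and> j \<bullet> Z \<omega> < t + \<delta> \<and>
      (\<forall>k\<in>J - {j}. beats j (j \<bullet> Z \<omega>) (W j \<omega>) k)} =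
    (\<integral>\<^sup>+x. ennreal (normal_density 0 (sqrt (q j)) x * prob (wins j x)) * indicator {t..<t + \<delta>} x \<partial>lborel)"
proof -
  let ?C = "{z. \<forall>k\<in>J - {j}. beats j (fst z) (snd z) k} \<inter> ({t..<t + \<delta>} \<times> UNIV)"
  have C: "?C \<in> sets (borel \<Otimes>\<^sub>M borel)" by (intro sets.Int C_sets pair_measureI) auto
  have "emeasure M {\<omega>\<in>space M. t \<le> j \<bullet> Z \<omega> \<and> j \<bullet> Z \<omega> < t + \<delta> \<and>
      (\<forall>k\<in>J - {j}. beats j (j \<bullet> Z \<omega>) (W j \<omega>) k)} = emeasure M {\<omega>\<in>space M. (j \<bullet> Z \<omega>, W j \<omega>) \<in> ?C}"
    by (intro arg_cong[where f="emeasure M"]) auto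
  also have "\<dots> = (\<integral>\<^sup>+x. ennreal (normal_density 0 (sqrt (q j)) x) * emeasure M {\<omega>\<in>space M. (x, W j \<omega>) \<in> ?C} \<partial>lborel)"
    by (rule emeasure_joint[OF assms C])
  also have "\<dots> = (\<integral>\<^sup>+x. ennreal (normal_density 0 (sqrt (q j)) x * prob (wins j x)) * indicator {t..<t + \<delta>} x \<partial>lborel)"
  proof (rule nn_integral_cong)
    fix x
    have "{\<omega>\<in>space M. (x, W j \<omega>) \<in> ?C} = (if x \<in> {t..<t + \<delta>} then wins j x else {})"
      by (auto simp: wins_def)
    then show "ennreal (normal_density 0 (sqrt (q j)) x) * emeasure M {\<omega>\<in>space M. (x, W j \<omega>) \<in> ?C} =
        ennreal (normal_density 0 (sqrt (q j)) x * prob (wins j x)) * indicator {t..<t + \<delta>} x"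
      by (auto simp: emeasure_eq_measure ennreal_mult)
  qed
  finally show ?thesis .
qed

text \<open>The events on the right partition the one on the left: among the maximisers the one of
  least rank beats all others, and two functionals cannot beat each other because their ranks
  differ.\<close>

lemma prob_max_eq_sum:
  "prob {\<omega>\<in>space M. t \<le> Max ((\<lambda>j. j \<bullet> Z \<omega>) ` J) \<and> Max ((\<lambda>j. j \<bullet> Z \<omega>) ` J) < t + \<delta>} =
    (\<Sum>j\<in>J. prob {\<omega>\<in>space M. t \<le> j \<bullet> Z \<omega> \<and> j \<bullet> Z \<omega> < t + \<delta> \<and>
      (\<forall>k\<in>J - {j}. beats j (j \<bullet> Z \<omega>) (W j \<omega>) k)})"
proof -
  let ?F = "\<lambda>j. {\<omega>\<in>space M. t \<le> j \<bullet> Z \<omega> \<and> j \<bullet> Z \<omega> < t + \<delta> \<and>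
      (\<forall>k\<in>J - {j}. beats j (j \<bullet> Z \<omega>) (W j \<omega>) k)}"
  have ev: "?F j \<in> events" for j
    by (intro sets.sets_Collect_conj sets.sets_Collect_finite_All finJ) measurable
  have dis: "disjoint_family_on ?F J"
    unfolding disjoint_family_on_def
  proof (intro ballI impI)
    fix j k assume jk: "j \<in> J" "k \<in> J" "j \<noteq> k"
    then have "r j \<noteq> r k" using r by (auto dest: inj_onD)
    then have "\<not> (beats j (j \<bullet> Z \<omega>) (W j \<omega>) k \<and> beats k (k \<bullet> Z \<omega>) (W k \<omega>) j)" for \<omega>
      unfolding beats_iff by auto
    with jk show "?F j \<inter> ?F k = {}" by auto
  qed
  have max: "Max ((\<lambda>j. j \<bullet> Z \<omega>) ` J) = j \<bullet> Z \<omega>"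
    if "j \<in> J" "\<forall>k\<in>J - {j}. beats j (j \<bullet> Z \<omega>) (W j \<omega>) k" for j \<omega>
  proof (rule Max_eqI)
    fix y assume "y \<in> (\<lambda>j. j \<bullet> Z \<omega>) ` J"
    then obtain k where k: "k \<in> J" "y = k \<bullet> Z \<omega>" by auto
    then show "y \<le> j \<bullet> Z \<omega>"
      using that(2) unfolding beats_iff by (cases "k = j") (auto split: if_splits intro: less_imp_le)
  qed (use J that in auto)
  have ex: "\<exists>j\<in>J. \<forall>k\<in>J - {j}. beats j (j \<bullet> Z \<omega>) (W j \<omega>) k" for \<omega>
  proof -
    let ?A = "{j\<in>J. j \<bullet> Z \<omega> = Max ((\<lambda>j. j \<bullet> Z \<omega>) ` J)}"
    have "Max ((\<lambda>j. j \<bullet> Z \<omega>) ` J) \<in> (\<lambda>j. j \<bullet> Z \<omega>) ` J" using J by (intro Max_in) auto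
    then obtain i where "i \<in> J" "Max ((\<lambda>j. j \<bullet> Z \<omega>) ` J) = i \<bullet> Z \<omega>" by (elim imageE)
    then have "i \<in> ?A" by simp
    then have A: "finite ?A" "?A \<noteq> {}" using J(1) by (simp, blast)
    define j where "j = arg_min_on r ?A"
    have j: "j \<in> ?A" "\<And>k. k \<in> ?A \<Longrightarrow> r j \<le> r k"
      unfolding j_def using arg_min_if_finite[OF A, of r] by (auto simp: not_less)
    have "beats j (j \<bullet> Z \<omega>) (W j \<omega>) k" if "k \<in> J - {j}" for k
    proof -
      have le: "k \<bullet> Z \<omega> \<le> j \<bullet> Z \<omega>" using that j(1) J(1) by auto
      moreover have "k \<bullet> Z \<omega> \<noteq> j \<bullet> Z \<omega>" if "r k < r j"
        using j(2)[of k] \<open>k \<in> J - {j}\<close> j(1) that by auto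
      ultimately show ?thesis unfolding beats_iff by auto
    qed
    moreover have "j \<in> J" using j(1) by simp
    ultimately show ?thesis by blast
  qed
  have "{\<omega>\<in>space M. t \<le> Max ((\<lambda>j. j \<bullet> Z \<omega>) ` J) \<and> Max ((\<lambda>j. j \<bullet> Z \<omega>) ` J) < t + \<delta>} = (\<Union>j\<in>J. ?F j)"
  proof (intro set_eqI iffI)
    fix \<omega> assume \<omega>: "\<omega> \<in> {\<omega>\<in>space M. t \<le> Max ((\<lambda>j. j \<bullet> Z \<omega>) ` J) \<and> Max ((\<lambda>j. j \<bullet> Z \<omega>) ` J) < t + \<delta>}"
    from ex[of \<omega>] obtain j where j: "j \<in> J" "\<forall>k\<in>J - {j}. beats j (j \<bullet> Z \<omega>) (W j \<omega>) k" by auto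
    then have "\<omega> \<in> ?F j" using \<omega> max[OF j] by auto
    then show "\<omega> \<in> (\<Union>j\<in>J. ?F j)" using j by auto
  next
    fix \<omega> assume "\<omega> \<in> (\<Union>j\<in>J. ?F j)"
    then obtain j where "j \<in> J" "\<omega> \<in> ?F j" by auto
    then show "\<omega> \<in> {\<omega>\<in>space M. t \<le> Max ((\<lambda>j. j \<bullet> Z \<omega>) ` J) \<and> Max ((\<lambda>j. j \<bullet> Z \<omega>) ` J) < t + \<delta>}"
      using max[of j \<omega>] by auto
  qed
  moreover have "prob (\<Union>j\<in>J. ?F j) = (\<Sum>j\<in>J. prob (?F j))"
    by (rule finite_measure_finite_Union[OF J(1) _ dis]) (use ev in blast)
  ultimately show ?thesis by (simp only:)
qed

text \<open>Each face is the integral of a normal density times \<open>prob (wins j x)\<close> over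
  a short interval. The density is continuous and the probability has a right limit, so the averages
  converge.\<close>

lemma tendsto_max_density:
  "((\<lambda>\<delta>. 1 / \<delta> * prob {\<omega>\<in>space M. t \<le> Max ((\<lambda>j. j \<bullet> Z \<omega>) ` J) \<and> Max ((\<lambda>j. j \<bullet> Z \<omega>) ` J) < t + \<delta>})
     \<longlongrightarrow> (\<Sum>j\<in>J. normal_density 0 (sqrt (q j)) t * prob (wins_right j t))) (at_right 0)"
  unfolding prob_max_eq_sum sum_distrib_left
proof (rule tendsto_sum)
  fix j assume j: "j \<in> J"
  let ?h = "\<lambda>x. normal_density 0 (sqrt (q j)) x * prob (wins j x)"
  have "isCont (normal_density 0 (sqrt (q j))) t"
    unfolding normal_density_def using J(3)[OF j] by (intro continuous_intros) (auto simp: q_def)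
  then have "(normal_density 0 (sqrt (q j)) \<longlongrightarrow> normal_density 0 (sqrt (q j)) t) (at_right t)"
    by (simp add: isCont_def filterlim_at_split)
  then have "(?h \<longlongrightarrow> normal_density 0 (sqrt (q j)) t * prob (wins_right j t)) (at_right t)"
    by (rule tendsto_mult[OF _ tendsto_prob_wins])
  then have "((\<lambda>\<delta>. 1 / \<delta> * enn2real (\<integral>\<^sup>+x. ennreal (?h x) * indicator {t..<t + \<delta>} x \<partial>lborel)) \<longlongrightarrow>
      normal_density 0 (sqrt (q j)) t * prob (wins_right j t)) (at_right 0)"
    by (rule tendsto_right_average[rotated 2]) auto
  then show "((\<lambda>\<delta>. 1 / \<delta> * prob {\<omega>\<in>space M. t \<le> j \<bullet> Z \<omega> \<and> j \<bullet> Z \<omega> < t + \<delta> \<and>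
      (\<forall>k\<in>J - {j}. beats j (j \<bullet> Z \<omega>) (W j \<omega>) k)}) \<longlongrightarrow>
      normal_density 0 (sqrt (q j)) t * prob (wins_right j t)) (at_right 0)"
    by (simp only: prob_face[OF j] measure_def)
qed

text \<open>Pushing the face \<open>j\<close> outwards along its normal sweeps out a region whose probability is the
  normal tail times \<^term>\<open>prob (wins_right j t)\<close>; these regions do not overlap, because two
  unit normals have inner product at most \<open>1\<close>.\<close>

lemma AE_regions_disjoint:
  assumes t: "0 < t" and jk: "j \<in> J" "k \<in> J" "j \<noteq> k"
  shows "AE \<omega> in M. \<not> (t < j \<bullet> Z \<omega> \<and> t < k \<bullet> Z \<omega> \<and>
    beats_right j t (W j \<omega>) k \<and> beats_right k t (W k \<omega>) j)"
proof -
  define s where "s = k \<bullet> (\<Sigma> *v j)"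
  have qj: "q j > 0" and qk: "q k > 0" using J(3) jk by (auto simp: q_def)
  have bj: "k \<bullet> \<beta> j = s / q j" by (simp add: \<beta>_def s_def)
  have bk: "j \<bullet> \<beta> k = s / q k" by (simp add: \<beta>_def s_def gaussian_vector_commute[OF gv, of j k])
  \<comment> \<open>The variance of the residual of \<open>k\<close> given \<open>j\<close>: its
    nonnegativity is Cauchy-Schwarz for the covariance \<open>s\<close>, and it vanishes in the
    equality case.\<close>
  have psd: "(k - (s / q j) *\<^sub>R j) \<bullet> (\<Sigma> *v (k - (s / q j) *\<^sub>R j)) = q k - s\<^sup>2 / q j"
    using qj gaussian_vector_commute[OF gv, of j k]
    by (simp add: matrix_vector_mult_diff_distrib matrix_vector_mult_scaleR inner_diff_left inner_diff_right
       s_def[symmetric] q_def[symmetric] power2_eq_square)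
  have le: "s\<^sup>2 \<le> q j * q k"
    using gaussian_vector_psd[OF gv, of "k - (s / q j) *\<^sub>R j"] qj unfolding psd by (simp add: field_simps)
  have psd': "(j - (s / q k) *\<^sub>R k) \<bullet> (\<Sigma> *v (j - (s / q k) *\<^sub>R k)) = q j - s\<^sup>2 / q k"
    using qk gaussian_vector_commute[OF gv, of j k]
    by (simp add: matrix_vector_mult_diff_distrib matrix_vector_mult_scaleR inner_diff_left inner_diff_right
       s_def[symmetric] q_def[symmetric] power2_eq_square)
  have kW: "k \<bullet> W j \<omega> = (k - (s / q j) *\<^sub>R j) \<bullet> Z \<omega>" and jW: "j \<bullet> W k \<omega> = (j - (s / q k) *\<^sub>R k) \<bullet> Z \<omega>" for \<omega>
    by (simp_all add: W_def inner_diff_right inner_diff_left bj bk)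
  \<comment> \<open>Only for perfectly correlated \<open>j\<close> and \<open>k\<close> is a null
    set discarded: their residuals then have variance zero.\<close>
  have ae: "AE \<omega> in M. s\<^sup>2 = q j * q k \<longrightarrow> k \<bullet> W j \<omega> = 0 \<and> j \<bullet> W k \<omega> = 0"
  proof (cases "s\<^sup>2 = q j * q k")
    case True
    have "AE \<omega> in M. k \<bullet> W j \<omega> = 0" unfolding kW
      using qj by (intro gaussian_vector_AE_0[OF gv]) (simp add: psd True)
    moreover have "AE \<omega> in M. j \<bullet> W k \<omega> = 0" unfolding jW
      using qk by (intro gaussian_vector_AE_0[OF gv]) (simp add: psd' True)
    ultimately show ?thesis by auto
  qed auto
  show ?thesis using ae
  proof eventually_elim
    case (elim \<omega>)
    show ?case
    proof
      assume H: "t < j \<bullet> Z \<omega> \<and> t < k \<bullet> Z \<omega> \<and> beats_right j t (W j \<omega>) k \<and> beats_right k t (W k \<omega>) j"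
      \<comment> \<open>With the excesses \<open>a\<close>, \<open>c\<close> over \<open>t\<close>,
        the two conditions say \<open>c \<le> s / q j * a\<close> and
        \<open>a \<le> s / q k * c\<close>. Multiplying them forces
        \<open>q j * q k \<le> s^2\<close>, hence equality in Cauchy-Schwarz.\<close>
      define a where "a = j \<bullet> Z \<omega> - t"
      define c where "c = k \<bullet> Z \<omega> - t"
      have ac: "a > 0" "c > 0" using H by (auto simp: a_def c_def)
      have "k \<bullet> W j \<omega> \<le> (1 - s / q j) * t" "j \<bullet> W k \<omega> \<le> (1 - s / q k) * t"
        using H unfolding beats_right_def bj bk by auto
      then have "c \<le> s / q j * a" "a \<le> s / q k * c"
        unfolding kW jW by (auto simp: a_def c_def inner_diff_left algebra_simps)
      then have l: "c * q j \<le> s * a" "a * q k \<le> s * c" using qj qk by (auto simp: field_simps)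
      then have "0 < s * a" using ac qj by (smt (verit) mult_pos_pos)
      then have s: "s > 0" using ac by (simp add: zero_less_mult_iff)
      have "(c * q j) * (a * q k) \<le> (s * a) * (s * c)"
        using ac qj qk s by (intro mult_mono[OF l]) auto
      then have "(a * c) * (q j * q k) \<le> (a * c) * s\<^sup>2" by (simp add: power2_eq_square mult_ac)
      then have "q j * q k \<le> s\<^sup>2" using ac by simp
      with le have eq: "s\<^sup>2 = q j * q k" by simp
      with elim have z: "k \<bullet> W j \<omega> = 0" "j \<bullet> W k \<omega> = 0" by auto
      \<comment> \<open>With vanishing residuals and \<open>t > 0\<close> the conditions become
        \<open>s \<le> q j\<close> and \<open>s \<le> q k\<close>. The tie-breaking makes one of
        them strict, which contradicts \<open>s^2 = q j * q k\<close>.\<close>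
      have rjk: "r j \<noteq> r k" using r jk by (auto dest: inj_onD)
      have A: "s \<le> q j" "r k < r j \<Longrightarrow> s < q j"
        using H t qj unfolding beats_right_def bj z by (auto simp: zero_less_mult_iff field_simps split: if_splits)
      have B: "s \<le> q k" "r j < r k \<Longrightarrow> s < q k"
        using H t qk unfolding beats_right_def bk z by (auto simp: zero_less_mult_iff field_simps split: if_splits)
      have "s * s < q j * q k"
      proof (cases "r k < r j")
        case True
        then show ?thesis using A(2) B(1) s qk by (intro mult_less_le_imp_less) auto
      next
        case False
        then show ?thesis using A(1) B(2) rjk s qj by (intro mult_le_less_imp_less) auto
      qed
      then show False using eq by (simp add: power2_eq_square)
    qed
  qed
qed

section \<open>Probabilities of the swept regions and the bound on the density\<close>

definition tail :: "real ^ 'p \<Rightarrow> real \<Rightarrow> real" where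
  "tail j t = prob {\<omega>\<in>space M. t < j \<bullet> Z \<omega>}"

lemma emeasure_tail:
  assumes "j \<in> J"
  shows "(\<integral>\<^sup>+x. ennreal (normal_density 0 (sqrt (q j)) x) * indicator {t<..} x \<partial>lborel) = ennreal (tail j t)"
proof -
  have "emeasure M {\<omega>\<in>space M. t < j \<bullet> Z \<omega>} = emeasure M {\<omega>\<in>space M. (j \<bullet> Z \<omega>, W j \<omega>) \<in> {t<..} \<times> UNIV}"
    by simp
  also have "\<dots> = (\<integral>\<^sup>+x. ennreal (normal_density 0 (sqrt (q j)) x) * emeasure M {\<omega>\<in>space M. (x, W j \<omega>) \<in> {t<..} \<times> UNIV} \<partial>lborel)"
    by (intro emeasure_joint assms pair_measureI) auto
  also have "\<dots> = (\<integral>\<^sup>+x. ennreal (normal_density 0 (sqrt (q j)) x) * indicator {t<..} x \<partial>lborel)"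
    by (intro nn_integral_cong) (auto simp: indicator_def emeasure_space_1)
  finally show ?thesis by (simp add: tail_def emeasure_eq_measure)
qed

text \<open>The region imposes one condition on \<open>j \<bullet> Z\<close> and one on its
  residual, and these are independent.\<close>

lemma prob_region:
  assumes "j \<in> J"
  shows "prob ({\<omega>\<in>space M. t < j \<bullet> Z \<omega>} \<inter> wins_right j t) = tail j t * prob (wins_right j t)"
proof -
  let ?C = "{t<..} \<times> {w. \<forall>k\<in>J - {j}. beats_right j t w k}"
  have "{w\<in>space borel. \<forall>k\<in>J - {j}. beats_right j t w k} \<in> sets borel"
    by (rule sets.sets_Collect_finite_All[OF _ finJ]) measurable
  then have C: "?C \<in> sets (borel \<Otimes>\<^sub>M borel)" by (intro pair_measureI) auto
  have "emeasure M ({\<omega>\<in>space M. t < j \<bullet> Z \<omega>} \<inter> wins_right j t) = emeasure M {\<omega>\<in>space M. (j \<bullet> Z \<omega>, W j \<omega>) \<in> ?C}"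
    by (intro arg_cong[where f="emeasure M"]) (auto simp: wins_right_def)
  also have "\<dots> = (\<integral>\<^sup>+x. ennreal (normal_density 0 (sqrt (q j)) x) * emeasure M {\<omega>\<in>space M. (x, W j \<omega>) \<in> ?C} \<partial>lborel)"
    by (rule emeasure_joint[OF assms C])
  also have "\<dots> = (\<integral>\<^sup>+x. ennreal (normal_density 0 (sqrt (q j)) x) * indicator {t<..} x * emeasure M (wins_right j t) \<partial>lborel)"
    by (intro nn_integral_cong) (auto simp: indicator_def wins_right_def)
  also have "\<dots> = ennreal (tail j t) * emeasure M (wins_right j t)"
    by (subst nn_integral_multc) (auto simp: emeasure_tail[OF assms])
  finally show ?thesis
    by (simp add: emeasure_eq_measure ennreal_mult'[symmetric] tail_def)
qed

lemma sum_tail_prob_le_1: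
  assumes t: "0 < t"
  shows "(\<Sum>j\<in>J. tail j t * prob (wins_right j t)) \<le> 1"
proof -
  let ?E = "\<lambda>j. {\<omega>\<in>space M. t < j \<bullet> Z \<omega>} \<inter> wins_right j t"
  have ev: "?E j \<in> events" for j by measurable
  have "AE \<omega> in M. \<forall>j\<in>J. \<forall>k\<in>J. j \<noteq> k \<longrightarrow> \<not> (\<omega> \<in> ?E j \<and> \<omega> \<in> ?E k)"
  proof (intro AE_finite_allI J(1))
    fix j k assume jk: "j \<in> J" "k \<in> J"
    show "AE \<omega> in M. j \<noteq> k \<longrightarrow> \<not> (\<omega> \<in> ?E j \<and> \<omega> \<in> ?E k)"
    proof (cases "j = k")
      case False
      show ?thesis using AE_regions_disjoint[OF t jk False]
        by eventually_elim (use jk False in \<open>auto simp: wins_right_def\<close>)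
    qed simp
  qed
  \<comment> \<open>Almost surely at most one region contains the point; integrating the sum of
    indicators gives the bound \<open>1\<close>.\<close>
  then have ae: "AE \<omega> in M. (\<Sum>j\<in>J. indicator (?E j) \<omega>) \<le> (1 :: real)"
  proof eventually_elim
    case (elim \<omega>)
    show ?case
    proof (cases "\<exists>j\<in>J. \<omega> \<in> ?E j")
      case True
      then obtain j where j: "j \<in> J" "\<omega> \<in> ?E j" by auto
      have "(\<Sum>k\<in>J. indicator (?E k) \<omega>) = (\<Sum>k\<in>J. if k = j then 1 else 0 :: real)"
        by (intro sum.cong refl) (use elim j in \<open>auto simp: indicator_def\<close>)
      then show ?thesis using J(1) j by simp
    next
      case False
      then have "(\<Sum>k\<in>J. indicator (?E k) \<omega>) = (0::real)" by (intro sum.neutral) (auto simp: indicator_def)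
      then show ?thesis by simp
    qed
  qed
  have int: "integrable M (\<lambda>\<omega>. indicator (?E j) \<omega> :: real)" for j
    using ev by (simp add: emeasure_eq_measure)
  have "(\<Sum>j\<in>J. tail j t * prob (wins_right j t)) = (\<Sum>j\<in>J. prob (?E j))"
    by (simp add: prob_region)
  also have "\<dots> = (\<Sum>j\<in>J. \<integral>\<omega>. indicator (?E j) \<omega> \<partial>M)"
    by (intro sum.cong refl) (simp add: sets.Int_space_eq2)
  also have "\<dots> = (\<integral>\<omega>. (\<Sum>j\<in>J. indicator (?E j) \<omega>) \<partial>M)"
    using int by (intro Bochner_Integration.integral_sum[symmetric]) auto
  also have "\<dots> \<le> (\<integral>\<omega>. 1 \<partial>M)"
    using ae int by (intro integral_mono_AE Bochner_Integration.integrable_sum) auto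
  finally show ?thesis by (simp add: prob_space)
qed

text \<open>Split at \<open>t = K * \<sigma>\<close>: below, the tail bound applies with
  \<open>t^2 / \<sigma>^2 \<le> K^2\<close>; above, the density is small and the probability is
  bounded by \<open>1\<close>. The sum of both bounds covers either case.\<close>

lemma density_term_le:
  assumes t: "0 < t" and K: "1 \<le> K" and j: "j \<in> J"
  shows "t * (normal_density 0 (sqrt (q j)) t * prob (wins_right j t)) \<le>
    (K\<^sup>2 + 1) * (tail j t * prob (wins_right j t)) + K * exp (- K\<^sup>2 / 2) / sqrt (2 * pi)"
proof -
  define \<sigma> where "\<sigma> = sqrt (q j)"
  define l where "l = prob (wins_right j t)"
  have \<sigma>: "0 < \<sigma>" using J(3)[OF j] by (simp add: \<sigma>_def q_def)
  have l: "0 \<le> l" "l \<le> 1" by (auto simp: l_def)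
  have T: "0 \<le> tail j t" by (simp add: tail_def)
  have c0: "0 \<le> K * exp (- K\<^sup>2 / 2) / sqrt (2 * pi)" using K by simp
  show ?thesis
  proof (cases "t / \<sigma> \<le> K")
    case True
    have "ennreal (t * normal_density 0 \<sigma> t) \<le> ennreal (t\<^sup>2 / \<sigma>\<^sup>2 + 1) * ennreal (tail j t)"
      using normal_tail_lower_bound[OF \<sigma> t] emeasure_tail[OF j, of t] by (simp add: \<sigma>_def)
    then have "t * normal_density 0 \<sigma> t \<le> (t\<^sup>2 / \<sigma>\<^sup>2 + 1) * tail j t"
      using T by (subst (asm) ennreal_mult[symmetric]) (auto simp: ennreal_le_iff)
    also have "t\<^sup>2 / \<sigma>\<^sup>2 \<le> K\<^sup>2"
      using True t \<sigma> by (simp add: power_divide[symmetric] power_mono)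
    finally have "t * normal_density 0 \<sigma> t \<le> (K\<^sup>2 + 1) * tail j t" using T by (simp add: mult_right_mono)
    then have "t * normal_density 0 \<sigma> t * l \<le> (K\<^sup>2 + 1) * tail j t * l" using l by (intro mult_right_mono)
    then show ?thesis using c0 by (simp add: \<sigma>_def l_def mult.assoc)
  next
    case False
    then have "t * normal_density 0 \<sigma> t \<le> K * exp (- K\<^sup>2 / 2) / sqrt (2 * pi)"
      using \<sigma> K by (intro mult_normal_density_le_of_large) auto
    moreover have "t * normal_density 0 \<sigma> t * l \<le> t * normal_density 0 \<sigma> t"
      using l t by (intro mult_right_le_one_le) auto
    moreover have "0 \<le> (K\<^sup>2 + 1) * (tail j t * l)" using T l by simp
    ultimately show ?thesis by (simp add: \<sigma>_def l_def mult.assoc)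
  qed
qed

lemma max_density:
  "\<exists>L. ((\<lambda>\<delta>. 1 / \<delta> * prob {\<omega>\<in>space M. t \<le> Max ((\<lambda>j. j \<bullet> Z \<omega>) ` J) \<and> Max ((\<lambda>j. j \<bullet> Z \<omega>) ` J) < t + \<delta>})
     \<longlongrightarrow> L) (at_right 0) \<and>
   (\<forall>K\<ge>1. 0 < t \<longrightarrow> t * L \<le> K\<^sup>2 + 1 + card J * (K * exp (- K\<^sup>2 / 2) / sqrt (2 * pi)))"
proof (intro exI conjI allI impI)
  show "((\<lambda>\<delta>. 1 / \<delta> * prob {\<omega>\<in>space M. t \<le> Max ((\<lambda>j. j \<bullet> Z \<omega>) ` J) \<and> Max ((\<lambda>j. j \<bullet> Z \<omega>) ` J) < t + \<delta>})
     \<longlongrightarrow> (\<Sum>j\<in>J. normal_density 0 (sqrt (q j)) t * prob (wins_right j t))) (at_right 0)"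
    by (rule tendsto_max_density)
  fix K :: real assume K: "1 \<le> K" and t: "0 < t"
  let ?c = "K * exp (- K\<^sup>2 / 2) / sqrt (2 * pi)"
  have "t * (\<Sum>j\<in>J. normal_density 0 (sqrt (q j)) t * prob (wins_right j t)) \<le>
    (\<Sum>j\<in>J. (K\<^sup>2 + 1) * (tail j t * prob (wins_right j t)) + ?c)"
    unfolding sum_distrib_left by (intro sum_mono density_term_le K t)
  also have "\<dots> = (K\<^sup>2 + 1) * (\<Sum>j\<in>J. tail j t * prob (wins_right j t)) + card J * ?c"
    by (simp add: sum.distrib sum_distrib_left)
  also have "\<dots> \<le> (K\<^sup>2 + 1) * 1 + card J * ?c"
    by (intro add_right_mono mult_left_mono sum_tail_prob_le_1 t) auto
  finally show "t * (\<Sum>j\<in>J. normal_density 0 (sqrt (q j)) t * prob (wins_right j t)) \<le>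
    K\<^sup>2 + 1 + card J * ?c" by simp
qed

end

section \<open>Anti-concentration\<close>

lemma gaussian_vector_linear:
  assumes "gaussian_vector M Z 0 \<Sigma>"
  shows "gaussian_vector M (\<lambda>\<omega>. A *v Z \<omega>) 0 (A ** \<Sigma> ** transpose A)"
proof -
  have Z [measurable]: "Z \<in> borel_measurable M" and S: "transpose \<Sigma> = \<Sigma>"
    and law: "\<And>u. distr M borel (\<lambda>\<omega>. u \<bullet> Z \<omega>) = normal_law 0 (u \<bullet> (\<Sigma> *v u))"
    using assms by (auto simp: gaussian_vector_def positive_semidefinite_def)
  have adj: "u \<bullet> (A *v z) = (transpose A *v u) \<bullet> z" for u z
    by (simp add: transpose_matrix_vector dot_lmul_matrix)
  have quad: "u \<bullet> ((A ** \<Sigma> ** transpose A) *v u) = (transpose A *v u) \<bullet> (\<Sigma> *v (transpose A *v u))" for u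
    by (simp only: matrix_vector_mul_assoc[symmetric] adj)
  show ?thesis
    unfolding gaussian_vector_def positive_semidefinite_def
  proof (intro conjI allI)
    show "(\<lambda>\<omega>. A *v Z \<omega>) \<in> borel_measurable M"
      by (rule measurable_compose[OF Z]) (auto intro!: borel_measurable_continuous_onI linear_continuous_on
          simp: linear_linear)
    show "transpose (A ** \<Sigma> ** transpose A) = A ** \<Sigma> ** transpose A"
      by (simp add: matrix_transpose_mul S matrix_mul_assoc)
    show "0 \<le> u \<bullet> ((A ** \<Sigma> ** transpose A) *v u)" for u
      unfolding quad by (rule gaussian_vector_psd[OF assms])
    show "distr M borel (\<lambda>\<omega>. u \<bullet> (A *v Z \<omega>)) =
        normal_law (u \<bullet> 0) (u \<bullet> ((A ** \<Sigma> ** transpose A) *v u))" for u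
      unfolding quad adj by (simp add: law)
  qed
qed

lemma borel_measurable_vec_nth [measurable (raw)]:
  fixes f :: "'a \<Rightarrow> real ^ 'p"
  assumes [measurable]: "f \<in> borel_measurable M"
  shows "(\<lambda>x. f x $ i) \<in> borel_measurable M"
proof -
  have "(\<lambda>x. axis i 1 \<bullet> f x) \<in> borel_measurable M" by measurable
  then show ?thesis by (simp add: inner_axis')
qed

lemma borel_measurable_Max_abs [measurable]:
  fixes Z :: "'a \<Rightarrow> real ^ 'p"
  assumes [measurable]: "Z \<in> borel_measurable M"
  shows "(\<lambda>\<omega>. Max (range (\<lambda>i. \<bar>Z \<omega> $ i\<bar>))) \<in> borel_measurable M"
  by (rule borel_measurable_Max) auto

text \<open>The absolute values are replaced by the functionals plus and minus
  \<open>axis i 1\<close> with positive variance, at most \<open>2 * CARD('p)\<close> of them. The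
  bound on \<open>t * L\<close> involves no variance, and the factor \<open>exp (1/2)\<close> is
  kept in reserve for the shrinking argument.\<close>

lemma gaussian_abs_max_density:
  fixes Z :: "'a \<Rightarrow> real ^ 'p"
  assumes M: "prob_space M" and gv: "gaussian_vector M Z 0 \<Sigma>"
    and i0: "0 < axis i0 1 \<bullet> (\<Sigma> *v axis i0 1)" and p: "3 \<le> CARD('p)"
  shows "\<exists>L. ((\<lambda>\<delta>. 1 / \<delta> * measure M {\<omega>\<in>space M. t \<le> Max (range (\<lambda>i. \<bar>Z \<omega> $ i\<bar>)) \<and>
      Max (range (\<lambda>i. \<bar>Z \<omega> $ i\<bar>)) < t + \<delta>}) \<longlongrightarrow> L) (at_right 0) \<and>
    (0 < t \<longrightarrow> exp (1/2) * (t * L) \<le> 4 * ln (2 * real CARD('p)))"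
proof -
  interpret prob_space M by (rule M)
  have [measurable]: "Z \<in> borel_measurable M" using gv by (simp add: gaussian_vector_def)
  define v where "v i = axis i 1 \<bullet> (\<Sigma> *v axis i 1)" for i :: 'p
  define J where "J = (\<lambda>(i, s). s *\<^sub>R axis i 1 :: real ^ 'p) ` ({i. 0 < v i} \<times> {1, -1})"
  have finJ: "finite J" unfolding J_def by (intro finite_imageI finite_cartesian_product) auto
  have J_inner: "(s *\<^sub>R axis i 1) \<bullet> z = s * z $ i" for s i and z :: "real ^ 'p"
    by (simp add: inner_axis')
  have "J \<noteq> {}" using i0 by (auto simp: J_def v_def)
  have minus: "\<Sigma> *v (- z) = - (\<Sigma> *v z)" for z
    using matrix_vector_mult_scaleR[of \<Sigma> "-1" z] by simp
  have Jpos: "0 < j \<bullet> (\<Sigma> *v j)" if "j \<in> J" for j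
    using that by (auto simp: J_def v_def minus)
  have "card J \<le> card ({i. 0 < v i} \<times> {1, -1 :: real})" unfolding J_def by (rule card_image_le) simp
  also have "\<dots> \<le> CARD('p) * 2" unfolding card_cartesian_product by (intro mult_mono card_mono) auto
  finally have cJ: "real (card J) \<le> 2 * real CARD('p)" by simp
  obtain r :: "real ^ 'p \<Rightarrow> nat" where r: "inj_on r J" using finite_imp_inj_to_nat_seg[OF finJ] by blast
  interpret F: ranked_gaussian_family M Z \<Sigma> J r
    by unfold_locales (fact gv finJ \<open>J \<noteq> {}\<close> Jpos r)+
  have "AE \<omega> in M. \<forall>i. v i = 0 \<longrightarrow> Z \<omega> $ i = 0"
  proof (subst AE_all_countable, rule allI)
    fix i
    show "AE \<omega> in M. v i = 0 \<longrightarrow> Z \<omega> $ i = 0"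
      using gaussian_vector_AE_0[OF gv, of "axis i 1"] by (cases "v i = 0") (auto simp: v_def inner_axis')
  qed
  then have ae: "AE \<omega> in M. Max (range (\<lambda>i. \<bar>Z \<omega> $ i\<bar>)) = Max ((\<lambda>j. j \<bullet> Z \<omega>) ` J)"
  proof eventually_elim
    case (elim \<omega>)
    have le: "\<bar>Z \<omega> $ i\<bar> \<le> Max ((\<lambda>j. j \<bullet> Z \<omega>) ` J)" if "0 < v i" for i
    proof -
      define s :: real where "s = (if 0 \<le> Z \<omega> $ i then 1 else -1)"
      have "s *\<^sub>R axis i 1 \<in> J" unfolding J_def
        by (rule image_eqI[of _ _ "(i, s)"]) (use that in \<open>auto simp: s_def\<close>)
      then have "(s *\<^sub>R axis i 1) \<bullet> Z \<omega> \<le> Max ((\<lambda>j. j \<bullet> Z \<omega>) ` J)"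
        using finJ by (intro Max_ge finite_imageI imageI)
      then show ?thesis unfolding J_inner by (auto simp: s_def split: if_splits)
    qed
    show ?case
    proof (rule antisym)
      have "\<bar>Z \<omega> $ i\<bar> \<le> Max ((\<lambda>j. j \<bullet> Z \<omega>) ` J)" for i
      proof (cases "0 < v i")
        case False
        \<comment> \<open>A coordinate of variance zero contributes \<open>0\<close>, and
          \<open>le\<close> at \<open>i0\<close> shows that the maximum over \<open>J\<close> is
          nonnegative.\<close>
        then have "v i = 0" using gaussian_vector_psd[OF gv, of "axis i 1"] by (simp add: v_def)
        then show ?thesis using elim le[of i0] i0 by (simp add: v_def)
      qed (rule le)
      then show "Max (range (\<lambda>i. \<bar>Z \<omega> $ i\<bar>)) \<le> Max ((\<lambda>j. j \<bullet> Z \<omega>) ` J)" by (intro Max.boundedI) auto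
      have "\<bar>Z \<omega> $ i\<bar> \<le> Max (range (\<lambda>i. \<bar>Z \<omega> $ i\<bar>))" for i by (intro Max_ge) auto
      then have "Z \<omega> $ i \<le> Max (range (\<lambda>i. \<bar>Z \<omega> $ i\<bar>))"
        "- (Z \<omega> $ i) \<le> Max (range (\<lambda>i. \<bar>Z \<omega> $ i\<bar>))" for i
        by (meson abs_ge_self abs_ge_minus_self order_trans)+
      then show "Max ((\<lambda>j. j \<bullet> Z \<omega>) ` J) \<le> Max (range (\<lambda>i. \<bar>Z \<omega> $ i\<bar>))"
        using finJ \<open>J \<noteq> {}\<close> by (intro Max.boundedI) (auto simp: J_def inner_axis')
    qed
  qed
  have [measurable]: "(\<lambda>\<omega>. Max ((\<lambda>j. j \<bullet> Z \<omega>) ` J)) \<in> borel_measurable M"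
    by (rule borel_measurable_Max[OF finJ]) measurable
  have eq: "prob {\<omega>\<in>space M. t \<le> Max (range (\<lambda>i. \<bar>Z \<omega> $ i\<bar>)) \<and> Max (range (\<lambda>i. \<bar>Z \<omega> $ i\<bar>)) < t + \<delta>} =
    prob {\<omega>\<in>space M. t \<le> Max ((\<lambda>j. j \<bullet> Z \<omega>) ` J) \<and> Max ((\<lambda>j. j \<bullet> Z \<omega>) ` J) < t + \<delta>}" for \<delta>
  proof (rule measure_eq_AE)
    show "AE \<omega> in M. (\<omega> \<in> {\<omega>\<in>space M. t \<le> Max (range (\<lambda>i. \<bar>Z \<omega> $ i\<bar>)) \<and> Max (range (\<lambda>i. \<bar>Z \<omega> $ i\<bar>)) < t + \<delta>}) =
      (\<omega> \<in> {\<omega>\<in>space M. t \<le> Max ((\<lambda>j. j \<bullet> Z \<omega>) ` J) \<and> Max ((\<lambda>j. j \<bullet> Z \<omega>) ` J) < t + \<delta>})"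
      using ae by eventually_elim (simp only: mem_Collect_eq)
  qed measurable
  obtain L where L: "((\<lambda>\<delta>. 1 / \<delta> * prob {\<omega>\<in>space M. t \<le> Max ((\<lambda>j. j \<bullet> Z \<omega>) ` J) \<and>
      Max ((\<lambda>j. j \<bullet> Z \<omega>) ` J) < t + \<delta>}) \<longlongrightarrow> L) (at_right 0)"
    and LK: "\<And>K. 1 \<le> K \<Longrightarrow> 0 < t \<Longrightarrow> t * L \<le> K\<^sup>2 + 1 + card J * (K * exp (- K\<^sup>2 / 2) / sqrt (2 * pi))"
    using F.max_density[of t] by blast
  have "exp (1/2) * (t * L) \<le> 4 * ln (2 * real CARD('p))" if t: "0 < t"
  proof -
    define n where "n = 2 * real CARD('p)"
    define K where "K = sqrt (2 * ln n - 2)"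
    have n: "6 \<le> n" using p by (simp add: n_def)
    have K: "1 \<le> K" unfolding K_def by (rule log_bound_aux(1)[OF n])
    have "t * L \<le> K\<^sup>2 + 1 + card J * (K * exp (- K\<^sup>2 / 2) / sqrt (2 * pi))" by (rule LK[OF K t])
    also have "\<dots> \<le> K\<^sup>2 + 1 + n * (K * exp (- K\<^sup>2 / 2) / sqrt (2 * pi))"
      using cJ K by (intro add_left_mono mult_right_mono) (auto simp: n_def)
    finally have "exp (1/2) * (t * L) \<le> exp (1/2) * (K\<^sup>2 + 1 + n * (K * exp (- K\<^sup>2 / 2) / sqrt (2 * pi)))"
      by (rule mult_left_mono) simp
    also have "\<dots> \<le> 4 * ln n" unfolding K_def by (rule log_bound_aux(2)[OF n])
    finally show ?thesis by (simp only: n_def)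
  qed
  with L show ?thesis unfolding eq by blast
qed

text \<open>Coordinate \<open>m\<close> is scaled by \<open>s\<close> while its residual is kept.
  After conditioning on the residual this compares two centred normal densities on the interval of
  radius \<open>a\<close> in which \<open>B\<close> confines coordinate \<open>m\<close>.\<close>

lemma gaussian_vector_shrink_compare:
  fixes Z :: "'a \<Rightarrow> real ^ 'p"
  assumes M: "prob_space M" and gv: "gaussian_vector M Z 0 \<Sigma>"
    and q: "q = axis m 1 \<bullet> (\<Sigma> *v axis m 1)" "0 < q" and b: "b = (1 / q) *\<^sub>R (\<Sigma> *v axis m 1)"
    and s: "0 < s" and B: "B \<in> sets borel" "\<And>z. z \<in> B \<Longrightarrow> \<bar>z $ m\<bar> \<le> a"
  shows "measure M {\<omega>\<in>space M. Z \<omega> \<in> B} \<le> s * exp (a\<^sup>2 / (2 * (s\<^sup>2 * q))) *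
    measure M {\<omega>\<in>space M. Z \<omega> - ((1 - s) * Z \<omega> $ m) *\<^sub>R b \<in> B}"
proof -
  interpret prob_space M by (rule M)
  have [measurable]: "Z \<in> borel_measurable M" using gv by (simp add: gaussian_vector_def)
  note B(1)[measurable]
  define \<sigma> where "\<sigma> = sqrt q"
  have \<sigma>: "0 < \<sigma>" "\<sigma>\<^sup>2 = q" using q(2) by (auto simp: \<sigma>_def)
  define W where "W \<omega> = Z \<omega> - (Z \<omega> $ m) *\<^sub>R b" for \<omega>
  have [measurable]: "W \<in> borel_measurable M" unfolding W_def by measurable
  \<comment> \<open>The probability that the residual lands in \<open>B\<close> once coordinate
    \<open>m\<close> is set to \<open>x\<close>. Since \<open>b $ m = 1\<close>, the residual has
    \<open>m\<close>-th coordinate \<open>0\<close>, so \<open>g x\<close> vanishes for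
    \<open>\<bar>x\<bar> > a\<close>.\<close>
  define g where "g x = emeasure M {\<omega>\<in>space M. W \<omega> + x *\<^sub>R b \<in> B}" for x
  define c where "c = exp (a\<^sup>2 / (2 * (s\<^sup>2 * q)))"
  have bm: "b $ m = 1" using q by (simp add: b inner_axis')
  have Wm: "W \<omega> $ m = 0" for \<omega> by (simp add: W_def bm)
  have joint: "emeasure M {\<omega>\<in>space M. W \<omega> + (y * Z \<omega> $ m) *\<^sub>R b \<in> B} =
    (\<integral>\<^sup>+x. ennreal (normal_density 0 \<sigma> x) * g (y * x) \<partial>lborel)" for y
  proof -
    have "{z \<in> space (borel \<Otimes>\<^sub>M borel). snd z + (y * fst z) *\<^sub>R b \<in> B} \<in> sets (borel \<Otimes>\<^sub>M borel)"
      by measurable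
    then have C: "{z. snd z + (y * fst z) *\<^sub>R b \<in> B} \<in> sets (borel \<Otimes>\<^sub>M borel)"
      by (simp add: space_pair_measure)
    show ?thesis
      using gaussian_vector_residual_emeasure[OF M gv q b C]
      by (simp add: inner_axis' W_def g_def \<sigma>_def)
  qed
  have [measurable]: "g \<in> borel_measurable borel"
  proof -
    let ?D = "distr M borel W" and ?C = "{z. snd z + fst z *\<^sub>R b \<in> B}"
    interpret D: prob_space ?D by (rule prob_space_distr) simp
    have "{z \<in> space (borel \<Otimes>\<^sub>M borel). snd z + fst z *\<^sub>R b \<in> B} \<in> sets (borel \<Otimes>\<^sub>M borel)"
      by measurable
    then have C: "?C \<in> sets (borel \<Otimes>\<^sub>M borel)" by (simp add: space_pair_measure)
    have "(\<lambda>x. emeasure ?D (Pair x -` ?C)) \<in> borel_measurable borel"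
      using D.measurable_emeasure_Pair[of ?C borel] C by (simp cong: sets_pair_measure_cong)
    moreover have "emeasure ?D (Pair x -` ?C) = g x" for x
      using sets_Pair1[OF C]
      by (subst emeasure_distr) (auto simp: g_def intro!: arg_cong[where f="emeasure M"])
    ultimately show ?thesis by (simp only:)
  qed
  \<comment> \<open>For \<open>\<bar>x\<bar> \<le> a\<close> the exponent
    \<open>(x / s)^2 / (2 * q)\<close> is at most \<open>a^2 / (2 * (s^2 * q))\<close>, so
    \<open>c\<close> compensates for the narrower density.\<close>
  have pt: "ennreal (normal_density 0 \<sigma> x) * g x \<le> ennreal c * (ennreal (normal_density 0 \<sigma> (x / s)) * g x)" for x
  proof (cases "\<bar>x\<bar> \<le> a")
    case True
    have "x\<^sup>2 \<le> a\<^sup>2" using True by (metis abs_ge_zero power2_abs power_mono)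
    then have "x\<^sup>2 / (2 * (s\<^sup>2 * q)) \<le> a\<^sup>2 / (2 * (s\<^sup>2 * q))" using s q by (intro divide_right_mono) auto
    moreover have "0 \<le> x\<^sup>2 / (2 * q)" using q by simp
    ultimately have "- x\<^sup>2 / (2 * q) \<le> a\<^sup>2 / (2 * (s\<^sup>2 * q)) + - (x / s)\<^sup>2 / (2 * q)"
      by (simp add: power_divide)
    then have "exp (- x\<^sup>2 / (2 * q)) \<le> c * exp (- (x / s)\<^sup>2 / (2 * q))"
      unfolding c_def mult_exp_exp by simp
    then have "exp (- x\<^sup>2 / (2 * q)) / (\<sigma> * sqrt (2 * pi)) \<le> c * exp (- (x / s)\<^sup>2 / (2 * q)) / (\<sigma> * sqrt (2 * pi))"
      using \<sigma> by (intro divide_right_mono) auto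
    then have "normal_density 0 \<sigma> x \<le> c * normal_density 0 \<sigma> (x / s)"
      unfolding normal_density_0_eq[OF \<sigma>(1)] \<sigma>(2) by simp
    then have "ennreal (normal_density 0 \<sigma> x) \<le> ennreal c * ennreal (normal_density 0 \<sigma> (x / s))"
      by (subst ennreal_mult[symmetric]) (auto simp: c_def intro!: ennreal_leI)
    then show ?thesis by (simp only: mult.assoc[symmetric] mult_right_mono zero_le)
  next
    case False
    have "(W \<omega> + x *\<^sub>R b) $ m = x" for \<omega> by (simp add: Wm bm)
    then have "{\<omega>\<in>space M. W \<omega> + x *\<^sub>R b \<in> B} = {}" using B(2) False by force
    then show ?thesis unfolding g_def by (simp only: emeasure_empty mult_zero_right order_refl)
  qed
  have Z1: "{\<omega>\<in>space M. Z \<omega> \<in> B} = {\<omega>\<in>space M. W \<omega> + (1 * Z \<omega> $ m) *\<^sub>R b \<in> B}" by (simp add: W_def)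
  have Z2: "{\<omega>\<in>space M. Z \<omega> - ((1 - s) * Z \<omega> $ m) *\<^sub>R b \<in> B} = {\<omega>\<in>space M. W \<omega> + (s * Z \<omega> $ m) *\<^sub>R b \<in> B}"
    by (simp add: W_def algebra_simps)
  have "emeasure M {\<omega>\<in>space M. Z \<omega> \<in> B} = (\<integral>\<^sup>+x. ennreal (normal_density 0 \<sigma> x) * g x \<partial>lborel)"
    unfolding Z1 joint by simp
  also have "\<dots> \<le> (\<integral>\<^sup>+x. ennreal c * (ennreal (normal_density 0 \<sigma> (x / s)) * g x) \<partial>lborel)"
    by (intro nn_integral_mono pt)
  also have "\<dots> = ennreal c * (\<integral>\<^sup>+x. ennreal (normal_density 0 \<sigma> (x / s)) * g x \<partial>lborel)"
    by (rule nn_integral_cmult) measurable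
  \<comment> \<open>Substituting \<open>s * x\<close> for \<open>x\<close> produces the prefactor
    \<open>s\<close> and restores the original density, now with \<open>g\<close> evaluated at the
    shrunk coordinate.\<close>
  also have "(\<integral>\<^sup>+x. ennreal (normal_density 0 \<sigma> (x / s)) * g x \<partial>lborel) =
    ennreal s * (\<integral>\<^sup>+x. ennreal (normal_density 0 \<sigma> x) * g (s * x) \<partial>lborel)"
    using s by (subst nn_integral_real_affine[where c=s and t=0]) auto
  also have "(\<integral>\<^sup>+x. ennreal (normal_density 0 \<sigma> x) * g (s * x) \<partial>lborel) =
    emeasure M {\<omega>\<in>space M. Z \<omega> - ((1 - s) * Z \<omega> $ m) *\<^sub>R b \<in> B}"
    unfolding Z2 joint ..
  finally have "ennreal (prob {\<omega>\<in>space M. Z \<omega> \<in> B}) \<le>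
    ennreal (s * c * prob {\<omega>\<in>space M. Z \<omega> - ((1 - s) * Z \<omega> $ m) *\<^sub>R b \<in> B})"
    using s by (simp add: emeasure_eq_measure ennreal_mult c_def mult_ac)
  then show ?thesis using s by (simp add: c_def)
qed

section \<open>Second moments and small balls of single coordinates\<close>

lemma gaussian_vector_second_moment:
  fixes Z :: "'a \<Rightarrow> real ^ 'p"
  assumes gv: "gaussian_vector M Z 0 \<Sigma>"
  shows "(\<integral>\<omega>. (Z \<omega> $ i)\<^sup>2 \<partial>M) = axis i 1 \<bullet> (\<Sigma> *v axis i 1)"
proof -
  define v where "v = axis i 1 \<bullet> (\<Sigma> *v axis i 1)"
  have v: "0 \<le> v" unfolding v_def by (rule gaussian_vector_psd[OF gv])
  have [measurable]: "Z \<in> borel_measurable M" using gv by (simp add: gaussian_vector_def)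
  have "(\<integral>\<omega>. (Z \<omega> $ i)\<^sup>2 \<partial>M) = (\<integral>x. x\<^sup>2 \<partial>distr M borel (\<lambda>\<omega>. axis i 1 \<bullet> Z \<omega>))"
    by (subst integral_distr) (auto simp: inner_axis')
  also have "distr M borel (\<lambda>\<omega>. axis i 1 \<bullet> Z \<omega>) = normal_law 0 v"
    using gv by (simp add: gaussian_vector_def v_def)
  also have "(\<integral>x. x\<^sup>2 \<partial>normal_law 0 v) = v"
  proof (cases "v = 0")
    case True
    then show ?thesis by (simp add: normal_law_def integral_return)
  next
    case False
    then have "(\<integral>x. x\<^sup>2 \<partial>normal_law 0 v) = (\<integral>x. normal_density 0 (sqrt v) x * (x - 0) ^ (2 * 1) \<partial>lborel)"
      by (simp add: normal_law_def integral_density)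
    also have "\<dots> = v" using v False by (subst integral_normal_moment_even) auto
    finally show ?thesis .
  qed
  finally show ?thesis by (simp add: v_def)
qed

text \<open>The density is at most \<open>1 / (2 * \<sigma>)\<close> and the interval has length
  \<open>2 * \<delta>\<close>. This serves the case \<open>t = 0\<close>, where a bound on
  \<open>t * L\<close> says nothing.\<close>

lemma gaussian_coordinate_small_ball:
  fixes Z :: "'a \<Rightarrow> real ^ 'p"
  assumes M: "prob_space M" and gv: "gaussian_vector M Z 0 \<Sigma>"
    and \<sigma>: "\<sigma>\<^sup>2 = axis m 1 \<bullet> (\<Sigma> *v axis m 1)" "0 < \<sigma>" and \<delta>: "0 < \<delta>"
  shows "measure M {\<omega>\<in>space M. \<bar>Z \<omega> $ m\<bar> < \<delta>} \<le> \<delta> / \<sigma>"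
proof -
  interpret prob_space M by (rule M)
  have [measurable]: "Z \<in> borel_measurable M" using gv by (simp add: gaussian_vector_def)
  have law: "distr M borel (\<lambda>\<omega>. axis m 1 \<bullet> Z \<omega>) = density lborel (normal_density 0 \<sigma>)"
    using gv \<sigma> by (simp add: gaussian_vector_def normal_law_def flip: \<sigma>(1))
  have nd: "normal_density 0 \<sigma> x \<le> 1 / (2 * \<sigma>)" for x
  proof -
    have "2 \<le> sqrt (2 * pi)" using pi_ge_two by (intro real_le_rsqrt) auto
    moreover have "exp (- x\<^sup>2 / (2 * \<sigma>\<^sup>2)) \<le> 1" by simp
    ultimately have "exp (- x\<^sup>2 / (2 * \<sigma>\<^sup>2)) / (\<sigma> * sqrt (2 * pi)) \<le> 1 / (\<sigma> * 2)"
      using \<sigma> by (intro frac_le mult_left_mono) auto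
    then show ?thesis using \<sigma> by (simp add: normal_density_0_eq mult.commute)
  qed
  have "emeasure M {\<omega>\<in>space M. \<bar>Z \<omega> $ m\<bar> < \<delta>} = emeasure (distr M borel (\<lambda>\<omega>. axis m 1 \<bullet> Z \<omega>)) {- \<delta><..<\<delta>}"
    by (subst emeasure_distr) (auto simp: inner_axis' abs_less_iff intro!: arg_cong[where f="emeasure M"])
  also have "\<dots> = (\<integral>\<^sup>+x. ennreal (normal_density 0 \<sigma> x) * indicator {- \<delta><..<\<delta>} x \<partial>lborel)"
    unfolding law by (rule emeasure_density) auto
  also have "\<dots> \<le> (\<integral>\<^sup>+x. ennreal (1 / (2 * \<sigma>)) * indicator {- \<delta><..<\<delta>} x \<partial>lborel)"
    by (intro nn_integral_mono mult_right_mono ennreal_leI nd) simp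
  also have "\<dots> = ennreal (1 / (2 * \<sigma>)) * ennreal (\<delta> + \<delta>)"
    using \<delta> by (subst nn_integral_cmult_indicator) auto
  also have "\<dots> = ennreal (\<delta> / \<sigma>)"
    using \<delta> \<sigma> by (subst ennreal_mult[symmetric]) (auto simp: field_simps)
  finally show ?thesis using \<delta> \<sigma> by (simp add: emeasure_eq_measure)
qed

theorem proposition5:
  fixes M :: "'a measure"
    and Z :: "'a \<Rightarrow> real ^ 'p"
    and \<Sigma> :: "real ^ 'p ^ 'p"
    and \<sigma>max t :: real
    and Mstar :: "'a \<Rightarrow> real"
  assumes "prob_space M"
    and "CARD('p) \<ge> 3"
    and "gaussian_vector M Z 0 \<Sigma>"
    and "\<exists>i. prob_space.variance M (\<lambda>\<omega>. Z \<omega> $ i) > 0"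
    and "\<sigma>max\<^sup>2 = Max (range (\<lambda>i. prob_space.expectation M (\<lambda>\<omega>. (Z \<omega> $ i)\<^sup>2)))"
    and "\<sigma>max > 0"
    and "Mstar = (\<lambda>\<omega>. Max (range (\<lambda>i. \<bar>Z \<omega> $ i\<bar>)))"
    and "t \<ge> 0"
  shows "\<exists>L. ((\<lambda>\<delta>. (1 / \<delta>) * \<P>(\<omega> in M. t \<le> Mstar \<omega> \<and> Mstar \<omega> < t + \<delta>)) \<longlongrightarrow> L) (at_right 0)
           \<and> L \<le> 4 * ln (2 * real CARD('p)) / max \<sigma>max t"
proof -
  note M = assms(1) and gv = assms(3) and p = assms(2) and \<sigma>pos = assms(6)
  interpret prob_space M by (rule M)
  have [measurable]: "Z \<in> borel_measurable M" using gv by (simp add: gaussian_vector_def)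
  define v where "v i = axis i 1 \<bullet> (\<Sigma> *v axis i 1)" for i :: 'p
  have "\<sigma>max\<^sup>2 = Max (range v)"
    using assms(5) by (simp add: gaussian_vector_second_moment[OF gv] v_def[abs_def])
  moreover have "Max (range v) \<in> range v" by (intro Max_in) auto
  ultimately obtain m where m: "\<sigma>max\<^sup>2 = v m" by (metis rangeE)
  have vm: "0 < v m" using m \<sigma>pos by (metis zero_less_power)
  let ?P = "\<lambda>Y \<delta>. prob {\<omega>\<in>space M. t \<le> Max (range (\<lambda>i. \<bar>Y \<omega> $ i\<bar>)) \<and> Max (range (\<lambda>i. \<bar>Y \<omega> $ i\<bar>)) < t + \<delta>}"
  let ?l = "4 * ln (2 * real CARD('p))"
  obtain L where L: "((\<lambda>\<delta>. 1 / \<delta> * ?P Z \<delta>) \<longlongrightarrow> L) (at_right 0)" and Lt: "0 < t \<Longrightarrow> exp (1/2) * (t * L) \<le> ?l"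
    using gaussian_abs_max_density[OF M gv vm[unfolded v_def] p, of t] by auto
  have coord: "\<bar>z $ m\<bar> \<le> Max (range (\<lambda>i. \<bar>z $ i\<bar>))" for z :: "real ^ 'p" by (intro Max_ge) auto
  have l1: "1 \<le> ?l"
  proof -
    have "exp 1 \<le> (3::real)" by (rule exp_le)
    also have "\<dots> \<le> 2 * real CARD('p)" using p by simp
    finally have "1 \<le> ln (2 * real CARD('p))" using p by (subst ln_ge_iff) auto
    then show ?thesis by simp
  qed
  have pos: "eventually (\<lambda>\<delta>::real. 0 < \<delta>) (at_right 0)" by (rule eventually_at_right_less)
  have L0: "0 \<le> L"
    using L by (rule tendsto_lowerbound) (use pos in \<open>auto elim!: eventually_mono\<close>)
  consider "t = 0" | "0 < t" "t < \<sigma>max" | "\<sigma>max \<le> t" using assms(8) by linarith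
  then have "L \<le> ?l / max \<sigma>max t"
  proof cases
    case 1
    have "L \<le> 1 / \<sigma>max"
    proof (rule tendsto_upperbound[OF L _ trivial_limit_at_right_real])
      show "\<forall>\<^sub>F \<delta> in at_right 0. 1 / \<delta> * ?P Z \<delta> \<le> 1 / \<sigma>max"
        using pos
      proof eventually_elim
        case (elim \<delta>)
        \<comment> \<open>At \<open>t = 0\<close> the event forces every coordinate, in particular
          the one of largest variance, below \<open>\<delta>\<close> in absolute value.\<close>
        have "?P Z \<delta> \<le> prob {\<omega>\<in>space M. \<bar>Z \<omega> $ m\<bar> < \<delta>}"
          using 1 coord by (intro finite_measure_mono) (auto intro: le_less_trans)
        also have "\<dots> \<le> \<delta> / \<sigma>max"
          by (rule gaussian_coordinate_small_ball[OF M gv m[unfolded v_def] \<sigma>pos elim])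
        finally show ?case using elim by (simp add: field_simps)
      qed
    qed
    also have "\<dots> \<le> ?l / \<sigma>max" using l1 \<sigma>pos by (intro divide_right_mono) auto
    finally show ?thesis using 1 \<sigma>pos by (simp add: max_def)
  next
    case 2
    \<comment> \<open>This factor brings the standard deviation of coordinate \<open>m\<close> down
      from \<open>\<sigma>max\<close> to \<open>t\<close>.\<close>
    define s where "s = t / \<sigma>max"
    define b where "b = (1 / v m) *\<^sub>R (\<Sigma> *v axis m 1)"
    define Y where "Y \<omega> = Z \<omega> - ((1 - s) * Z \<omega> $ m) *\<^sub>R b" for \<omega>
    define f where "f z = z - ((1 - s) * z $ m) *\<^sub>R b" for z
    have s: "0 < s" "s\<^sup>2 * v m = t\<^sup>2" using 2 \<sigma>pos by (auto simp: s_def power_divide m[symmetric])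
    have "linear f" unfolding f_def by (intro linearI) (auto simp: algebra_simps)
    then have mf: "matrix f *v z = f z" for z by (rule fun_cong[OF matrix_vector_mul(2)])
    have gY: "gaussian_vector M Y 0 (matrix f ** \<Sigma> ** transpose (matrix f))"
      using gaussian_vector_linear[OF gv, of "matrix f"] by (simp add: mf f_def Y_def[abs_def])
    have bm: "b $ m = 1" using vm by (simp add: b_def v_def inner_axis')
    \<comment> \<open>Coordinate \<open>m\<close> of \<open>f z\<close> is \<open>s * z $ m\<close>
      because \<open>b $ m = 1\<close>. Hence the shrunk vector has variance
      \<open>s^2 * v m = t^2\<close> there, so it is non-trivial.\<close>
    have tr: "transpose (matrix f) *v axis m 1 = s *\<^sub>R axis m 1"
    proof (rule vector_eq_ldot[THEN iffD1], rule allI)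
      fix z
      have "z \<bullet> (transpose (matrix f) *v axis m 1) = axis m 1 \<bullet> (matrix f *v z)"
        by (metis dot_lmul_matrix inner_commute transpose_matrix_vector)
      also have "\<dots> = s * z $ m" by (simp add: mf inner_axis' f_def bm algebra_simps)
      finally show "z \<bullet> (transpose (matrix f) *v axis m 1) = z \<bullet> (s *\<^sub>R axis m 1)"
        by (simp add: inner_axis)
    qed
    have "axis m 1 \<bullet> ((matrix f ** \<Sigma> ** transpose (matrix f)) *v axis m 1) =
      (transpose (matrix f) *v axis m 1) \<bullet> (\<Sigma> *v (transpose (matrix f) *v axis m 1))"
      by (simp only: matrix_vector_mul_assoc[symmetric] transpose_matrix_vector dot_lmul_matrix)
    also have "\<dots> = s\<^sup>2 * v m"
      unfolding tr by (simp add: matrix_vector_mult_scaleR v_def power2_eq_square)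
    finally have "0 < axis m 1 \<bullet> ((matrix f ** \<Sigma> ** transpose (matrix f)) *v axis m 1)"
      using s 2 by simp
    from gaussian_abs_max_density[OF M gY this p, of t] obtain L'
      where L': "((\<lambda>\<delta>. 1 / \<delta> * ?P Y \<delta>) \<longlongrightarrow> L') (at_right 0)" and Lt': "exp (1/2) * (t * L') \<le> ?l"
      using 2 by auto
    \<comment> \<open>The comparison is applied with \<open>a = t + \<delta>\<close> before passing
      to the limit; then \<open>(t + \<delta>)^2 / (2 * t^2)\<close> tends to
      \<open>1/2\<close>.\<close>
    have "L \<le> s * exp ((t + 0)\<^sup>2 / (2 * t\<^sup>2)) * L'"
    proof (rule tendsto_le[OF trivial_limit_at_right_real _ L])
      show "((\<lambda>\<delta>. s * exp ((t + \<delta>)\<^sup>2 / (2 * t\<^sup>2)) * (1 / \<delta> * ?P Y \<delta>)) \<longlongrightarrow> s * exp ((t + 0)\<^sup>2 / (2 * t\<^sup>2)) * L') (at_right 0)"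
        using 2 by (intro tendsto_mult L' tendsto_intros) auto
      show "\<forall>\<^sub>F \<delta> in at_right 0. 1 / \<delta> * ?P Z \<delta> \<le> s * exp ((t + \<delta>)\<^sup>2 / (2 * t\<^sup>2)) * (1 / \<delta> * ?P Y \<delta>)"
        using pos
      proof eventually_elim
        case (elim \<delta>)
        let ?B = "{z :: real ^ 'p. t \<le> Max (range (\<lambda>i. \<bar>z $ i\<bar>)) \<and> Max (range (\<lambda>i. \<bar>z $ i\<bar>)) < t + \<delta>}"
        have "{z \<in> space borel. t \<le> Max (range (\<lambda>i. \<bar>z $ i :: real\<bar>)) \<and> Max (range (\<lambda>i. \<bar>z $ i\<bar>)) < t + \<delta>} \<in> sets (borel :: (real ^ 'p) measure)"
          by measurable
        then have B: "?B \<in> sets borel" by simp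
        have "\<bar>z $ m\<bar> \<le> t + \<delta>" if "z \<in> ?B" for z 
          using that le_less_trans[OF coord[of z], of "t + \<delta>"] by (simp only: mem_Collect_eq less_imp_le)
        from gaussian_vector_shrink_compare[OF M gv v_def vm b_def s(1) B this]
        have "?P Z \<delta> \<le> s * exp ((t + \<delta>)\<^sup>2 / (2 * t\<^sup>2)) * ?P Y \<delta>"
          unfolding s(2) Y_def by simp
        then have "1 / \<delta> * ?P Z \<delta> \<le> 1 / \<delta> * (s * exp ((t + \<delta>)\<^sup>2 / (2 * t\<^sup>2)) * ?P Y \<delta>)"
          using elim by (intro mult_left_mono) auto
        then show ?case by (simp add: mult_ac)
      qed
    qed
    \<comment> \<open>Here \<open>s = t / \<sigma>max\<close> turns \<open>s * L'\<close> into
      \<open>t * L' / \<sigma>max\<close>, and the price \<open>exp (1/2)\<close> is the factor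
      already included in \<open>Lt'\<close>.\<close>
    also have "\<dots> = (exp (1/2) * (t * L')) / \<sigma>max" using 2 by (simp add: s_def)
    also have "\<dots> \<le> ?l / \<sigma>max" using Lt' \<sigma>pos by (intro divide_right_mono) auto
    finally show ?thesis using 2 by (simp add: max_def)
  next
    case 3
    then have t: "0 < t" using \<sigma>pos by simp
    \<comment> \<open>The reserve factor is dropped here, which is legitimate because
      \<open>L\<close> is nonnegative.\<close>
    have "1 * (t * L) \<le> exp (1/2) * (t * L)" using t L0 by (intro mult_right_mono) auto
    then have "t * L \<le> ?l" using Lt[OF t] by simp
    then show ?thesis using 3 t by (simp add: max_def field_simps)
  qed
  with L show ?thesis unfolding assms(7) by auto
qed

end
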